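(* Let $\mathcal{H}(T,A,\mu)$ be a small Cauchy--de Branges space (i.e. $\sum_n\mu_n<\infty$). Assume that $T$ is power separated with exponent $N$ and that $(t_n^{2N}\mu_n)_n\in\ell^p$ for some $p>0$. Let $\gamma\ne0$ and $$B_\gamma(z)=A(z)\Big(\gamma+\sum_n\frac{\mu_n}{t_n-z}\Big).$$ If all zeros of $B_\gamma$ are simple, then the family of normalized reproducing kernels $\{\tilde K_w\}_{w\in\mathcal{Z}(B_\gamma)}$ is a Riesz basis in $\mathcal{H}(T,A,\mu)$. In particular, this holds when $\mathcal{H}(T,A,\mu)$ is small and $T$ is separated, i.e. $|t_n-t_m|\ge\delta$ for some $\delta>0$ and all $n\ne m$.
   Context: Let $T=\{t_n\}_{n\ge1}\subset\mathbb{C}$ be a set of distinct points with $|t_n|\to\infty$, and let $\mu_n>0$ satisfy $\sum_n\frac{\mu_n}{|t_n|^2+1}<\infty$. Let $A$ be an entire function with simple zeros exactly at the points of $T$ and no other zeros. The Cauchy--de Branges space is $\mathcal{H}(T,A,\mu)=\{F(z)=A(z)\sum_n\frac{c_n\mu_n^{1/2}}{z-t_n}:(c_n)\in\ell^2\}$ with norm $\|F\|=\|(c_n)\|_{\ell^2}$; it is a reproducing kernel Hilbert space with kernel $K_w$ at $w$ (i.e. $F(w)=(F,K_w)$), and $\tilde K_w=K_w/\|K_w\|$. The sequence $T$ is power separated with exponent $N$ if there exist $C>0$ and $N>-1$ such that $\operatorname{dist}(t_n,T\setminus\{t_n\})\ge C(|t_n|+1)^{-N}$ for all $n$. *)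

theory Defs
  imports "HOL-Analysis.Analysis"
begin

text \<open>The entire function z \<mapsto> A z / (z - t n), extended at z = t n by its limit A'(t n).\<close>
definition cdb_quot :: "(nat \<Rightarrow> complex) \<Rightarrow> (complex \<Rightarrow> complex) \<Rightarrow> nat \<Rightarrow> complex \<Rightarrow> complex" where
  "cdb_quot t A n z = (if z = t n then deriv A (t n) else A z / (z - t n))"

definition cdb_space :: "(nat \<Rightarrow> complex) \<Rightarrow> (complex \<Rightarrow> complex) \<Rightarrow> (nat \<Rightarrow> real) \<Rightarrow> (complex \<Rightarrow> complex) set" where
  "cdb_space t A \<mu> = {F. \<exists>c::nat \<Rightarrow> complex. summable (\<lambda>n. (cmod (c n))\<^sup>2) \<and>
       (\<forall>z. F z = (\<Sum>n. c n * complex_of_real (sqrt (\<mu> n)) * cdb_quot t A n z))}"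

text \<open>The coefficient sequence (c_n) of F (recovered from F(t_n) = c_n mu_n^(1/2) A'(t_n)).\<close>
definition cdb_coeff :: "(nat \<Rightarrow> complex) \<Rightarrow> (complex \<Rightarrow> complex) \<Rightarrow> (nat \<Rightarrow> real) \<Rightarrow> (complex \<Rightarrow> complex) \<Rightarrow> nat \<Rightarrow> complex" where
  "cdb_coeff t A \<mu> F n = F (t n) / (complex_of_real (sqrt (\<mu> n)) * deriv A (t n))"

definition cdb_inner :: "(nat \<Rightarrow> complex) \<Rightarrow> (complex \<Rightarrow> complex) \<Rightarrow> (nat \<Rightarrow> real) \<Rightarrow> (complex \<Rightarrow> complex) \<Rightarrow> (complex \<Rightarrow> complex) \<Rightarrow> complex" where
  "cdb_inner t A \<mu> F G = (\<Sum>n. cdb_coeff t A \<mu> F n * cnj (cdb_coeff t A \<mu> G n))"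

definition cdb_norm :: "(nat \<Rightarrow> complex) \<Rightarrow> (complex \<Rightarrow> complex) \<Rightarrow> (nat \<Rightarrow> real) \<Rightarrow> (complex \<Rightarrow> complex) \<Rightarrow> real" where
  "cdb_norm t A \<mu> F = sqrt (\<Sum>n. (cmod (cdb_coeff t A \<mu> F n))\<^sup>2)"

definition cdb_kernel :: "(nat \<Rightarrow> complex) \<Rightarrow> (complex \<Rightarrow> complex) \<Rightarrow> (nat \<Rightarrow> real) \<Rightarrow> complex \<Rightarrow> complex \<Rightarrow> complex" where
  "cdb_kernel t A \<mu> w = (THE K. K \<in> cdb_space t A \<mu> \<and>
       (\<forall>F \<in> cdb_space t A \<mu>. F w = cdb_inner t A \<mu> F K))"

definition cdb_nkernel :: "(nat \<Rightarrow> complex) \<Rightarrow> (complex \<Rightarrow> complex) \<Rightarrow> (nat \<Rightarrow> real) \<Rightarrow> complex \<Rightarrow> complex \<Rightarrow> complex" where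
  "cdb_nkernel t A \<mu> w = (\<lambda>z. cdb_kernel t A \<mu> w z /
       complex_of_real (cdb_norm t A \<mu> (cdb_kernel t A \<mu> w)))"

definition cdb_riesz_basis :: "(nat \<Rightarrow> complex) \<Rightarrow> (complex \<Rightarrow> complex) \<Rightarrow> (nat \<Rightarrow> real) \<Rightarrow> 'i set \<Rightarrow> ('i \<Rightarrow> complex \<Rightarrow> complex) \<Rightarrow> bool" where
  "cdb_riesz_basis t A \<mu> I x \<longleftrightarrow>
     (\<forall>i\<in>I. x i \<in> cdb_space t A \<mu>) \<and>
     (\<forall>F \<in> cdb_space t A \<mu>. \<forall>\<epsilon>>0. \<exists>S a. finite S \<and> S \<subseteq> I \<and>
         cdb_norm t A \<mu> (\<lambda>z. F z - (\<Sum>i\<in>S. a i * x i z)) < \<epsilon>) \<and>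
     (\<exists>c C. 0 < c \<and> c \<le> C \<and> (\<forall>S a. finite S \<longrightarrow> S \<subseteq> I \<longrightarrow>
         c * (\<Sum>i\<in>S. (cmod (a i))\<^sup>2) \<le> (cdb_norm t A \<mu> (\<lambda>z. \<Sum>i\<in>S. a i * x i z))\<^sup>2 \<and>
         (cdb_norm t A \<mu> (\<lambda>z. \<Sum>i\<in>S. a i * x i z))\<^sup>2 \<le> C * (\<Sum>i\<in>S. (cmod (a i))\<^sup>2)))"

text \<open>B_gamma(z) = A(z) (gamma + sum_n mu_n / (t_n - z)), written with the entire extension
  A(z)/(t_n - z) = - cdb_quot t A n z.\<close>
definition cdb_B :: "(nat \<Rightarrow> complex) \<Rightarrow> (complex \<Rightarrow> complex) \<Rightarrow> (nat \<Rightarrow> real) \<Rightarrow> complex \<Rightarrow> complex \<Rightarrow> complex" where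
  "cdb_B t A \<mu> \<gamma> z = \<gamma> * A z - (\<Sum>n. complex_of_real (\<mu> n) * cdb_quot t A n z)"

definition power_separated :: "(nat \<Rightarrow> complex) \<Rightarrow> real \<Rightarrow> bool" where
  "power_separated t N \<longleftrightarrow> N > -1 \<and> (\<exists>C>0. \<forall>n. \<forall>m. m \<noteq> n \<longrightarrow>
       cmod (t n - t m) \<ge> C * (cmod (t n) + 1) powr (-N))"

definition separated :: "(nat \<Rightarrow> complex) \<Rightarrow> bool" where
  "separated t \<longleftrightarrow> (\<exists>\<delta>>0. \<forall>n m. n \<noteq> m \<longrightarrow> cmod (t n - t m) \<ge> \<delta>)"

end

theory Submission
  imports Defs "HOL-Complex_Analysis.Conformal_Mappings"
begin

text \<open>
  In coefficient coordinates the kernel at a zero w of B is, up to a scalar and complex conjugation,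
  the vector v w with entries sqrt (mu n) / (w - t n). A partial fraction identity shows that
  distinct zeros give v w, v w' with vanishing bilinear pairing, while the pairing of v w with
  itself is a nonzero multiple of the derivative of B at w. Hence the theorem follows from three
  facts: a Bessel bound for the normalised vectors, a uniform lower bound for their bilinear squares,
  and totality.

  Everything rests on one estimate: if d n is a lower bound for the distance from t n to the other
  points and mu n / (d n)^2 tends to 0, then the sum of mu m / |z - t m| over the m with
  d m <= 2 |z - t m| tends to 0 as z tends to infinity. Terms with |z - t m| >= 1 are controlled by
  the tail of mu, the others by an area argument, because the discs of radius d m / 2 around the
  t m are disjoint. Consequently every large zero w lies close to exactly one t n, where v w has a
  dominating entry; the remaining entries are handled by Schur's test with weights sqrt (mu n).

  For totality, a vector annihilating all v w yields an entire function vanishing on the zeros of B;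
  its quotient h by B grows polynomially, by the estimate away from the points t n and the maximum
  principle near them, so h is a polynomial. Comparing both sides at points tending to infinity away
  from the t n forces h = 0.
\<close>

subsection \<open>Packing estimates\<close>

text \<open>The system biorthogonal to the kernel vectors consists, up to scalars bounded away from
  0, of their own complex conjugates. Bessel bounds are invariant under conjugation, so by duality
  the one upper estimate also yields the lower Riesz inequality. This is why all pairings are
  bilinear; conjugation returns at the very end, at the price of a unimodular factor. The obstacle
  is that distances between the points may shrink, so that summability of \<open>\<mu>\<close> alone
  does not control terms with \<open>t m\<close> close to z. The further hypothesis on
  \<open>\<mu>\<close> is used in the form mu n / (d n)^2 -> 0: it replaces mu m by a small multiple
  of (d m)^2, comparable to the area of a disc around \<open>t m\<close>, and the sum is then
  compared with the integral of 1/|z - s| over a disc in the plane, which converges. Zeros are not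
  counted. Orthogonality itself excludes two large zeros near the same \<open>t n\<close>; whether
  every \<open>t n\<close> attracts a zero is left undecided, because totality is proved
  separately.\<close>

lemma sum_radius_power2_le:
  fixes p :: "'i \<Rightarrow> complex"
  assumes fin: "finite F" and r: "\<And>m. m \<in> F \<Longrightarrow> r m \<ge> 0" and "R \<ge> 0"
    and disj: "\<And>m n. m \<in> F \<Longrightarrow> n \<in> F \<Longrightarrow> m \<noteq> n \<Longrightarrow> r m + r n \<le> dist (p m) (p n)"
    and sub: "\<And>m. m \<in> F \<Longrightarrow> ball (p m) (r m) \<subseteq> ball x R"
  shows "(\<Sum>m\<in>F. (r m)\<^sup>2) \<le> R\<^sup>2"
proof -
  have "disjoint_family_on (\<lambda>m. ball (p m) (r m)) F"
    unfolding disjoint_family_on_def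
  proof (intro ballI impI)
    fix m n assume "m \<in> F" "n \<in> F" "m \<noteq> n"
    then show "ball (p m) (r m) \<inter> ball (p n) (r n) = {}"
      using disj by (intro disjoint_ballI) auto
  qed
  moreover have "emeasure lborel (ball (p m) (r m)) \<noteq> \<infinity>" for m
    using emeasure_lborel_ball_finite[of "p m" "r m"] by simp
  ultimately have "measure lborel (\<Union>m\<in>F. ball (p m) (r m)) = (\<Sum>m\<in>F. measure lborel (ball (p m) (r m)))"
    using fin by (intro measure_finite_Union) auto
  moreover have "measure lborel (\<Union>m\<in>F. ball (p m) (r m)) \<le> measure lborel (ball x R)"
  proof (rule measure_mono_fmeasurable)
    show "(\<Union>m\<in>F. ball (p m) (r m)) \<subseteq> ball x R" using sub by blast
    show "ball x R \<in> fmeasurable lborel"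
      using emeasure_lborel_ball_finite[of x R] by (intro fmeasurableI) auto
    show "(\<Union>m\<in>F. ball (p m) (r m)) \<in> sets lborel" using fin by auto
  qed
  moreover have "(\<Sum>m\<in>F. measure lborel (ball (p m) (r m))) = unit_ball_vol 2 * (\<Sum>m\<in>F. (r m)\<^sup>2)"
    using r by (simp add: content_ball sum_distrib_left)
  moreover have "measure lborel (ball x R) = unit_ball_vol 2 * R\<^sup>2"
    using \<open>R \<ge> 0\<close> by (simp add: content_ball)
  moreover have "unit_ball_vol (2::real) > 0" by simp
  ultimately show ?thesis by simp
qed

text \<open>A discrete form of the integrability of 1/|x| in the plane. In the shell where the
  distance lies between 2^-(j+1) and 2^-j, the disjoint discs of radius \<open>d m / 2\<close> lie
  in the disc of radius 2 * 2^-j about \<open>x\<close>, since \<open>d m / 2\<close> is at most the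
  distance. Comparing areas bounds the sum of the (d m)^2 by 16 * 4^-j; dividing by 2^-(j+1) leaves
  32 * 2^-j, and the shells add up to 64.\<close>

lemma sum_separation_power2_div_dist_le:
  fixes p :: "'i \<Rightarrow> complex"
  assumes fin: "finite F" and d: "\<And>m. m \<in> F \<Longrightarrow> d m > 0"
    and sep: "\<And>m n. m \<in> F \<Longrightarrow> n \<in> F \<Longrightarrow> m \<noteq> n \<Longrightarrow> d m + d n \<le> 2 * dist (p m) (p n)"
    and far: "\<And>m. m \<in> F \<Longrightarrow> d m \<le> 2 * dist x (p m)"
    and near: "\<And>m. m \<in> F \<Longrightarrow> dist x (p m) < 1"
  shows "(\<Sum>m\<in>F. (d m)\<^sup>2 / dist x (p m)) \<le> 64"
proof -
  have ex: "\<exists>k. (1/2::real)^(Suc k) \<le> s \<and> s < (1/2)^k" if "0 < s" "s < 1" for s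
  proof -
    define k where "k = (LEAST k. (1/2::real)^(Suc k) \<le> s)"
    have "\<exists>k. (1/2::real)^(Suc k) \<le> s"
    proof -
      obtain k where "(1/2::real)^k < s" using real_arch_pow_inv[OF \<open>0 < s\<close>, of "1/2"] by auto
      moreover have "(1/2::real)^(Suc k) \<le> (1/2)^k" by simp
      ultimately show ?thesis by (intro exI[of _ k]) linarith
    qed
    then have 1: "(1/2::real)^(Suc k) \<le> s" unfolding k_def by (rule LeastI_ex)
    have "s < (1/2)^k"
    proof (cases k)
      case 0 then show ?thesis using that by simp
    next
      case (Suc j)
      then have "\<not> (1/2::real)^(Suc j) \<le> s"
        using not_less_Least[of j "\<lambda>k. (1/2::real)^(Suc k) \<le> s"] unfolding k_def by simp
      then show ?thesis using Suc by simp
    qed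
    with 1 show ?thesis by blast
  qed
  have dpos: "dist x (p m) > 0" if "m \<in> F" for m using d[OF that] far[OF that] by linarith
  obtain k where k: "\<And>m. m \<in> F \<Longrightarrow> (1/2::real)^(Suc (k m)) \<le> dist x (p m) \<and> dist x (p m) < (1/2)^(k m)"
  proof -
    have "\<forall>m\<in>F. \<exists>k. (1/2::real)^(Suc k) \<le> dist x (p m) \<and> dist x (p m) < (1/2)^k"
      using ex dpos near by blast
    then show thesis using that by (metis (no_types, lifting) bchoice)
  qed
  have shell: "(\<Sum>m\<in>{m\<in>F. k m = j}. (d m)\<^sup>2 / dist x (p m)) \<le> 32 * (1/2)^j" for j
  proof -
    let ?G = "{m\<in>F. k m = j}"
    have "(\<Sum>m\<in>?G. (d m / 2)\<^sup>2) \<le> (2 * (1/2)^j)\<^sup>2"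
    proof (rule sum_radius_power2_le[where p = p and x = x])
      show "finite ?G" using fin by simp
      show "0 \<le> d m / 2" if "m \<in> ?G" for m using d[of m] that by simp
      show "0 \<le> 2 * (1/2::real)^j" by simp
      show "d m / 2 + d n / 2 \<le> dist (p m) (p n)" if "m \<in> ?G" "n \<in> ?G" "m \<noteq> n" for m n
        using sep[of m n] that by simp
      show "ball (p m) (d m / 2) \<subseteq> ball x (2 * (1 / 2) ^ j)" if "m \<in> ?G" for m
      proof
        fix y assume "y \<in> ball (p m) (d m / 2)"
        then have "dist (p m) y < d m / 2" by simp
        moreover have "dist x y \<le> dist x (p m) + dist (p m) y" by (rule dist_triangle)
        moreover have "d m / 2 \<le> dist x (p m)" using far[of m] that by simp
        moreover have "dist x (p m) < (1/2)^j" using k[of m] that by simp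
        ultimately show "y \<in> ball x (2 * (1/2)^j)" unfolding mem_ball by linarith
      qed
    qed
    then have A: "(\<Sum>m\<in>?G. (d m)\<^sup>2) \<le> 16 * ((1/2)^j)\<^sup>2"
      by (simp add: power_divide sum_divide_distrib[symmetric] power_mult_distrib)
    have "(\<Sum>m\<in>?G. (d m)\<^sup>2 / dist x (p m)) \<le> (\<Sum>m\<in>?G. (d m)\<^sup>2 * (2 * 2^j))"
    proof (rule sum_mono)
      fix m assume m: "m \<in> ?G"
      then have "(1/2::real)^(Suc j) \<le> dist x (p m)" using k[of m] by simp
      then have "1 / dist x (p m) \<le> 1 / (1/2::real)^(Suc j)"
        using dpos[of m] m by (intro divide_left_mono) auto
      also have "\<dots> = 2 * 2^j" by (simp add: power_divide)
      finally have "(d m)\<^sup>2 * (1 / dist x (p m)) \<le> (d m)\<^sup>2 * (2 * 2^j)" by (intro mult_left_mono) auto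
      then show "(d m)\<^sup>2 / dist x (p m) \<le> (d m)\<^sup>2 * (2 * 2^j)" by simp
    qed
    also have "\<dots> = (\<Sum>m\<in>?G. (d m)\<^sup>2) * (2 * 2^j)" by (simp add: sum_distrib_right)
    also have "\<dots> \<le> 16 * ((1/2)^j)\<^sup>2 * (2 * 2^j)" using A by (intro mult_right_mono) auto
    also have "\<dots> = 32 * (1/2)^j" by (simp add: power2_eq_square power_divide)
    finally show ?thesis .
  qed
  have "(\<Sum>m\<in>F. (d m)\<^sup>2 / dist x (p m)) = (\<Sum>j\<in>k ` F. \<Sum>m\<in>{m\<in>F. k m = j}. (d m)\<^sup>2 / dist x (p m))"
    by (rule sum.image_gen[OF fin])
  also have "\<dots> \<le> (\<Sum>j\<in>k ` F. 32 * (1/2)^j)" by (intro sum_mono shell)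
  also have "\<dots> \<le> (\<Sum>j. 32 * (1/2::real)^j)"
    using fin by (intro sum_le_suminf summable_mult summable_geometric) auto
  also have "\<dots> = 64" by (simp add: suminf_mult summable_geometric suminf_geometric)
  finally show ?thesis .
qed

subsection \<open>Square summable sequences\<close>

lemma summable_norm_mult_l2:
  fixes f g :: "nat \<Rightarrow> complex"
  assumes "summable (\<lambda>n. (cmod (f n))\<^sup>2)" "summable (\<lambda>n. (cmod (g n))\<^sup>2)"
  shows "summable (\<lambda>n. cmod (f n * g n))"
proof (rule summable_comparison_test'[of _ 0])
  show "summable (\<lambda>n. (cmod (f n))\<^sup>2 + (cmod (g n))\<^sup>2)" using assms by (rule summable_add)
  fix n
  have "2 * (cmod (f n) * cmod (g n)) \<le> (cmod (f n))\<^sup>2 + (cmod (g n))\<^sup>2"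
    using sum_squares_bound[of "cmod (f n)" "cmod (g n)"] by simp
  moreover have "0 \<le> cmod (f n) * cmod (g n)" by simp
  ultimately show "norm (cmod (f n * g n)) \<le> (cmod (f n))\<^sup>2 + (cmod (g n))\<^sup>2"
    unfolding norm_mult real_norm_def abs_mult abs_norm_cancel by linarith
qed

lemma summable_mult_l2:
  fixes f g :: "nat \<Rightarrow> complex"
  assumes "summable (\<lambda>n. (cmod (f n))\<^sup>2)" "summable (\<lambda>n. (cmod (g n))\<^sup>2)"
  shows "summable (\<lambda>n. f n * g n)"
  using summable_norm_mult_l2[OF assms] by (rule summable_norm_cancel)

lemma norm_add_power2_le:
  fixes x y :: "'a::real_normed_vector"
  shows "(norm (x + y))\<^sup>2 \<le> 2 * (norm x)\<^sup>2 + 2 * (norm y)\<^sup>2"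
proof -
  have "(norm (x + y))\<^sup>2 \<le> (norm x + norm y)\<^sup>2"
    by (intro power_mono norm_triangle_ineq) simp
  also have "\<dots> \<le> 2 * (norm x)\<^sup>2 + 2 * (norm y)\<^sup>2"
    using sum_squares_bound[of "norm x" "norm y"] by (simp add: power2_sum)
  finally show ?thesis .
qed

lemma summable_add_l2:
  fixes f g :: "nat \<Rightarrow> complex"
  assumes "summable (\<lambda>n. (cmod (f n))\<^sup>2)" "summable (\<lambda>n. (cmod (g n))\<^sup>2)"
  shows "summable (\<lambda>n. (cmod (f n + g n))\<^sup>2)"
proof (rule summable_comparison_test'[of _ 0])
  show "summable (\<lambda>n. 2 * (cmod (f n))\<^sup>2 + 2 * (cmod (g n))\<^sup>2)"
    using assms by (intro summable_add summable_mult)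
  show "norm ((cmod (f n + g n))\<^sup>2) \<le> 2 * (cmod (f n))\<^sup>2 + 2 * (cmod (g n))\<^sup>2" for n
    using norm_add_power2_le[of "f n" "g n"] by simp
qed

lemma summable_cmult_l2:
  fixes f :: "nat \<Rightarrow> complex"
  assumes "summable (\<lambda>n. (cmod (f n))\<^sup>2)"
  shows "summable (\<lambda>n. (cmod (a * f n))\<^sup>2)"
  using summable_mult[OF assms, of "(cmod a)\<^sup>2"] by (simp add: norm_mult power_mult_distrib)

lemma summable_diff_l2:
  fixes f g :: "nat \<Rightarrow> complex"
  assumes "summable (\<lambda>n. (cmod (f n))\<^sup>2)" "summable (\<lambda>n. (cmod (g n))\<^sup>2)"
  shows "summable (\<lambda>n. (cmod (f n - g n))\<^sup>2)"
  using summable_add_l2[OF assms(1) summable_cmult_l2[OF assms(2), of "-1"]] by simp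

lemma summable_sum_l2:
  fixes V :: "'i \<Rightarrow> nat \<Rightarrow> complex"
  assumes "\<And>i. i \<in> S \<Longrightarrow> summable (\<lambda>n. (cmod (V i n))\<^sup>2)"
  shows "summable (\<lambda>n. (cmod (\<Sum>i\<in>S. a i * V i n))\<^sup>2)"
  using assms
proof (induction S rule: infinite_finite_induct)
  case (insert i S)
  then show ?case using summable_add_l2[OF summable_cmult_l2[of "V i" "a i"]] by simp
qed auto

lemma Cauchy_Schwarz_l2:
  fixes f g :: "nat \<Rightarrow> complex"
  assumes f: "summable (\<lambda>n. (cmod (f n))\<^sup>2)" and g: "summable (\<lambda>n. (cmod (g n))\<^sup>2)"
  shows "(cmod (\<Sum>n. f n * g n))\<^sup>2 \<le> (\<Sum>n. (cmod (f n))\<^sup>2) * (\<Sum>n. (cmod (g n))\<^sup>2)"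
proof -
  have "(cmod (\<Sum>n<N. f n * g n))\<^sup>2 \<le> (\<Sum>n. (cmod (f n))\<^sup>2) * (\<Sum>n. (cmod (g n))\<^sup>2)" for N
  proof -
    have "cmod (\<Sum>n<N. f n * g n) \<le> (\<Sum>n<N. cmod (f n) * cmod (g n))"
      using norm_sum[of "\<lambda>n. f n * g n" "{..<N}"] by (simp add: norm_mult)
    then have "(cmod (\<Sum>n<N. f n * g n))\<^sup>2 \<le> (\<Sum>n<N. cmod (f n) * cmod (g n))\<^sup>2"
      by (intro power_mono) auto
    also have "\<dots> \<le> (\<Sum>n<N. (cmod (f n))\<^sup>2) * (\<Sum>n<N. (cmod (g n))\<^sup>2)"
      by (rule Cauchy_Schwarz_ineq_sum)
    also have "\<dots> \<le> (\<Sum>n. (cmod (f n))\<^sup>2) * (\<Sum>n. (cmod (g n))\<^sup>2)"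
      by (intro mult_mono sum_le_suminf suminf_nonneg f g sum_nonneg) auto
    finally show ?thesis .
  qed
  moreover have "(\<lambda>N. (cmod (\<Sum>n<N. f n * g n))\<^sup>2) \<longlonglongrightarrow> (cmod (\<Sum>n. f n * g n))\<^sup>2"
    by (intro tendsto_intros summable_LIMSEQ summable_mult_l2 f g)
  ultimately show ?thesis by (intro LIMSEQ_le_const2) auto
qed

lemma power2_le_suminf_l2:
  fixes f :: "nat \<Rightarrow> complex"
  assumes "summable (\<lambda>n. (cmod (f n))\<^sup>2)"
  shows "(cmod (f n))\<^sup>2 \<le> (\<Sum>n. (cmod (f n))\<^sup>2)"
  using sum_le_suminf[OF assms, of "{n}"] by simp

text \<open>The limit is taken coordinatewise. A bound on the partial sums over n survives the limit
  in \<open>l\<close>, as in Fatou's lemma, which gives both the membership of the limit in l2 and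
  the convergence in norm.\<close>

lemma complete_l2:
  fixes g :: "nat \<Rightarrow> nat \<Rightarrow> complex"
  assumes g: "\<And>k. summable (\<lambda>n. (cmod (g k n))\<^sup>2)"
    and cau: "\<And>e. e > 0 \<Longrightarrow> \<exists>K. \<forall>k\<ge>K. \<forall>l\<ge>k. (\<Sum>n. (cmod (g l n - g k n))\<^sup>2) \<le> e"
  obtains G where "summable (\<lambda>n. (cmod (G n))\<^sup>2)"
    "\<And>e. e > 0 \<Longrightarrow> \<exists>K. \<forall>k\<ge>K. (\<Sum>n. (cmod (G n - g k n))\<^sup>2) \<le> e"
proof -
  have dg: "summable (\<lambda>n. (cmod (g l n - g k n))\<^sup>2)" for k l by (intro summable_diff_l2 g)
  have "Cauchy (\<lambda>k. g k n)" for n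
  proof (rule CauchyI')
    fix e :: real assume e: "e > 0"
    then obtain K where K: "\<forall>k\<ge>K. \<forall>l\<ge>k. (\<Sum>n. (cmod (g l n - g k n))\<^sup>2) \<le> (e/2)\<^sup>2"
      using cau[of "(e/2)\<^sup>2"] by auto
    have "dist (g k n) (g l n) < e" if "k \<ge> K" "l > k" for k l
    proof -
      have "(cmod (g l n - g k n))\<^sup>2 \<le> (e/2)\<^sup>2"
        using power2_le_suminf_l2[OF dg, of l n k] K that by (meson less_imp_le order_trans)
      then have "cmod (g l n - g k n) \<le> e / 2" using e by (simp add: power2_le_iff_abs_le)
      then show ?thesis using e by (simp add: dist_norm norm_minus_commute)
    qed
    then show "\<exists>M. \<forall>m\<ge>M. \<forall>l>m. dist (g m n) (g l n) < e" by blast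
  qed
  then have G: "(\<lambda>k. g k n) \<longlonglongrightarrow> lim (\<lambda>k. g k n)" for n
    by (simp add: Cauchy_convergent_iff convergent_LIMSEQ_iff)
  define G where "G n = lim (\<lambda>k. g k n)" for n
  note G = G[folded G_def]
  have fatou: "summable (\<lambda>n. (cmod (G n - g k n))\<^sup>2) \<and> (\<Sum>n. (cmod (G n - g k n))\<^sup>2) \<le> e"
    if le: "\<forall>l\<ge>k. (\<Sum>n. (cmod (g l n - g k n))\<^sup>2) \<le> e" for k e
  proof -
    have part: "(\<Sum>n<N. (cmod (G n - g k n))\<^sup>2) \<le> e" for N
    proof (rule LIMSEQ_le_const2)
      show "(\<lambda>l. \<Sum>n<N. (cmod (g l n - g k n))\<^sup>2) \<longlonglongrightarrow> (\<Sum>n<N. (cmod (G n - g k n))\<^sup>2)"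
        by (intro tendsto_intros G)
      show "\<exists>M. \<forall>l\<ge>M. (\<Sum>n<N. (cmod (g l n - g k n))\<^sup>2) \<le> e"
      proof (intro exI[of _ k] allI impI)
        fix l assume "l \<ge> k"
        have "(\<Sum>n<N. (cmod (g l n - g k n))\<^sup>2) \<le> (\<Sum>n. (cmod (g l n - g k n))\<^sup>2)"
          by (intro sum_le_suminf dg) auto
        then show "(\<Sum>n<N. (cmod (g l n - g k n))\<^sup>2) \<le> e" using le \<open>l \<ge> k\<close> by fastforce
      qed
    qed
    have "summable (\<lambda>n. (cmod (G n - g k n))\<^sup>2)"
      by (rule summableI_nonneg_bounded[OF _ part]) auto
    moreover from this have "(\<Sum>n. (cmod (G n - g k n))\<^sup>2) \<le> e"
      by (rule suminf_le_const[OF _ part])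
    ultimately show ?thesis ..
  qed
  obtain K where "\<forall>k\<ge>K. \<forall>l\<ge>k. (\<Sum>n. (cmod (g l n - g k n))\<^sup>2) \<le> 1" using cau[of 1] by auto
  then have "summable (\<lambda>n. (cmod (G n - g K n))\<^sup>2)" using fatou[of K 1] by auto
  from summable_add_l2[OF this g[of K]] have "summable (\<lambda>n. (cmod (G n))\<^sup>2)" by simp
  moreover have "\<exists>K. \<forall>k\<ge>K. (\<Sum>n. (cmod (G n - g k n))\<^sup>2) \<le> e" if "e > 0" for e
    using cau[OF that] fatou by meson
  ultimately show thesis using that by blast
qed

text \<open>A total Bessel system that is biorthogonal, up to scalars bounded below, to its own complex
  conjugate is a Riesz basis. The sets S exhaust the index set and only serve to order the expansion.\<close>

locale biorthogonal_bessel =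
  fixes V :: "'i \<Rightarrow> nat \<Rightarrow> complex" and I :: "'i set" and C c :: real and S :: "nat \<Rightarrow> 'i set"
  assumes l2: "\<And>i. i \<in> I \<Longrightarrow> summable (\<lambda>n. (cmod (V i n))\<^sup>2)"
    and bessel: "\<And>F a. finite F \<Longrightarrow> F \<subseteq> I \<Longrightarrow>
        (\<Sum>n. (cmod (\<Sum>i\<in>F. a i * V i n))\<^sup>2) \<le> C * (\<Sum>i\<in>F. (cmod (a i))\<^sup>2)"
    and orth: "\<And>i j. i \<in> I \<Longrightarrow> j \<in> I \<Longrightarrow> i \<noteq> j \<Longrightarrow> (\<Sum>n. V i n * V j n) = 0"
    and diag: "\<And>i. i \<in> I \<Longrightarrow> c \<le> cmod (\<Sum>n. V i n * V i n)"
    and c_pos: "c > 0" and C_pos: "C > 0"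
    and total: "\<And>f. summable (\<lambda>n. (cmod (f n))\<^sup>2) \<Longrightarrow> (\<And>i. i \<in> I \<Longrightarrow> (\<Sum>n. f n * V i n) = 0) \<Longrightarrow> f = (\<lambda>n. 0)"
    and S_fin: "\<And>k. finite (S k)" and S_mono: "\<And>k l. k \<le> l \<Longrightarrow> S k \<subseteq> S l" and S_Un: "(\<Union>k. S k) = I"
begin

text \<open>An operator and its transpose have the same norm. Concretely, the Bessel bound is tested
  on the conjugates of the pairings themselves: with X the left-hand side, Cauchy-Schwarz gives X^2
  \<le> |f|^2 * C * X, and one factor X cancels.\<close>

lemma dual_bessel:
  assumes F: "finite F" "F \<subseteq> I" and f: "summable (\<lambda>n. (cmod (f n))\<^sup>2)"
  shows "(\<Sum>i\<in>F. (cmod (\<Sum>n. f n * V i n))\<^sup>2) \<le> C * (\<Sum>n. (cmod (f n))\<^sup>2)"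
proof -
  define s where "s i = (\<Sum>n. f n * V i n)" for i
  define X where "X = (\<Sum>i\<in>F. (cmod (s i))\<^sup>2)"
  have V: "summable (\<lambda>n. (cmod (V i n))\<^sup>2)" if "i \<in> F" for i using l2 F that by auto
  have "complex_of_real X = (\<Sum>i\<in>F. cnj (s i) * (\<Sum>n. f n * V i n))"
    unfolding X_def s_def[symmetric] of_real_sum
    by (intro sum.cong refl) (metis complex_norm_square mult.commute of_real_power)
  also have "\<dots> = (\<Sum>i\<in>F. \<Sum>n. cnj (s i) * (f n * V i n))"
    using V by (intro sum.cong refl suminf_mult[symmetric] summable_mult_l2 f)
  also have "\<dots> = (\<Sum>n. \<Sum>i\<in>F. cnj (s i) * (f n * V i n))"
    using V by (intro suminf_sum[symmetric] summable_mult summable_mult_l2 f)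
  also have "\<dots> = (\<Sum>n. f n * (\<Sum>i\<in>F. cnj (s i) * V i n))"
    by (simp add: sum_distrib_left algebra_simps)
  finally have eq: "complex_of_real X = (\<Sum>n. f n * (\<Sum>i\<in>F. cnj (s i) * V i n))" .
  have X0: "X \<ge> 0" unfolding X_def by (intro sum_nonneg) auto
  have f0: "(\<Sum>n. (cmod (f n))\<^sup>2) \<ge> 0" by (intro suminf_nonneg f) auto
  have "X\<^sup>2 = (cmod (complex_of_real X))\<^sup>2" by simp
  also have "\<dots> \<le> (\<Sum>n. (cmod (f n))\<^sup>2) * (\<Sum>n. (cmod (\<Sum>i\<in>F. cnj (s i) * V i n))\<^sup>2)"
    unfolding eq by (intro Cauchy_Schwarz_l2 f summable_sum_l2 V)
  also have "\<dots> \<le> (\<Sum>n. (cmod (f n))\<^sup>2) * (C * X)"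
    using bessel[OF F, of "\<lambda>i. cnj (s i)"] f0 unfolding X_def by (intro mult_left_mono) auto
  finally have "X * X \<le> (C * (\<Sum>n. (cmod (f n))\<^sup>2)) * X" by (simp add: power2_eq_square algebra_simps)
  then have "X \<le> C * (\<Sum>n. (cmod (f n))\<^sup>2)"
    using X0 f0 C_pos by (cases "X = 0") auto
  then show ?thesis unfolding X_def s_def .
qed

lemma pairing_sum:
  assumes F: "finite F" "F \<subseteq> I" and j: "j \<in> I"
  shows "(\<Sum>n. (\<Sum>i\<in>F. a i * V i n) * V j n) = (if j \<in> F then a j * (\<Sum>n. V j n * V j n) else 0)"
proof -
  have V: "summable (\<lambda>n. V i n * V j n)" if "i \<in> F" for i
    using l2 F that j by (intro summable_mult_l2) auto
  have "(\<Sum>n. (\<Sum>i\<in>F. a i * V i n) * V j n) = (\<Sum>n. \<Sum>i\<in>F. a i * (V i n * V j n))"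
    by (simp add: sum_distrib_right mult.assoc)
  also have "\<dots> = (\<Sum>i\<in>F. a i * (\<Sum>n. V i n * V j n))"
    using V by (subst suminf_sum) (auto intro!: summable_mult sum.cong suminf_mult)
  also have "\<dots> = (\<Sum>i\<in>F. if i = j then a j * (\<Sum>n. V j n * V j n) else 0)"
    using F j by (intro sum.cong refl) (auto simp: orth)
  finally show ?thesis using F by simp
qed

text \<open>The dual bound is applied to the linear combination itself: pairing it with
  \<open>V j\<close> isolates \<open>a j\<close> times the diagonal entry, whose modulus is at least
  \<open>c\<close>.\<close>

lemma lower_bound:
  assumes F: "finite F" "F \<subseteq> I"
  shows "c\<^sup>2 / C * (\<Sum>i\<in>F. (cmod (a i))\<^sup>2) \<le> (\<Sum>n. (cmod (\<Sum>i\<in>F. a i * V i n))\<^sup>2)"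
proof -
  have "c\<^sup>2 * (\<Sum>i\<in>F. (cmod (a i))\<^sup>2) \<le> (\<Sum>j\<in>F. (cmod (\<Sum>n. (\<Sum>i\<in>F. a i * V i n) * V j n))\<^sup>2)"
    unfolding sum_distrib_left
  proof (rule sum_mono)
    fix j assume j: "j \<in> F"
    then have "j \<in> I" using F by auto
    have "c\<^sup>2 \<le> (cmod (\<Sum>n. V j n * V j n))\<^sup>2" using diag[OF \<open>j \<in> I\<close>] c_pos by (intro power_mono) auto
    then have "c\<^sup>2 * (cmod (a j))\<^sup>2 \<le> (cmod (\<Sum>n. V j n * V j n))\<^sup>2 * (cmod (a j))\<^sup>2"
      by (intro mult_right_mono) auto
    also have "\<dots> = (cmod (\<Sum>n. (\<Sum>i\<in>F. a i * V i n) * V j n))\<^sup>2"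
      by (subst pairing_sum[OF F \<open>j \<in> I\<close>]) (simp add: j norm_mult power_mult_distrib)
    finally show "c\<^sup>2 * (cmod (a j))\<^sup>2 \<le> (cmod (\<Sum>n. (\<Sum>i\<in>F. a i * V i n) * V j n))\<^sup>2" .
  qed
  also have "\<dots> \<le> C * (\<Sum>n. (cmod (\<Sum>i\<in>F. a i * V i n))\<^sup>2)"
    using F l2 by (intro dual_bessel summable_sum_l2) auto
  finally show ?thesis using C_pos by (simp add: field_simps)
qed

text \<open>Biorthogonality forces the coefficients. The dual bound makes them square summable, the
  Bessel bound then makes the expansions along \<open>S k\<close> Cauchy, and their limit has the
  same pairings as \<open>f\<close>; totality identifies the two.\<close>

lemma approximation:
  assumes f: "summable (\<lambda>n. (cmod (f n))\<^sup>2)" and e: "e > 0"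
  shows "\<exists>F a. finite F \<and> F \<subseteq> I \<and> (\<Sum>n. (cmod (f n - (\<Sum>i\<in>F. a i * V i n)))\<^sup>2) \<le> e"
proof -
  define a where "a i = (\<Sum>n. f n * V i n) / (\<Sum>n. V i n * V i n)" for i
  define g where "g k n = (\<Sum>i\<in>S k. a i * V i n)" for k n
  define \<sigma> where "\<sigma> k = (\<Sum>i\<in>S k. (cmod (a i))\<^sup>2)" for k
  have SI: "S k \<subseteq> I" for k using S_Un by auto
  have gl2: "summable (\<lambda>n. (cmod (g k n))\<^sup>2)" for k
    unfolding g_def using SI l2 by (intro summable_sum_l2) auto
  have "\<sigma> k \<le> C * (\<Sum>n. (cmod (f n))\<^sup>2) / c\<^sup>2" for k
  proof -
    have "c\<^sup>2 * \<sigma> k \<le> (\<Sum>i\<in>S k. (cmod (\<Sum>n. f n * V i n))\<^sup>2)"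
      unfolding \<sigma>_def sum_distrib_left
    proof (rule sum_mono)
      fix i assume "i \<in> S k"
      then have i: "c \<le> cmod (\<Sum>n. V i n * V i n)" using SI diag by auto
      then have "(\<Sum>n. V i n * V i n) \<noteq> 0" using c_pos by auto
      then have "(\<Sum>n. f n * V i n) = a i * (\<Sum>n. V i n * V i n)" by (simp add: a_def)
      then have "(cmod (\<Sum>n. f n * V i n))\<^sup>2 = (cmod (a i))\<^sup>2 * (cmod (\<Sum>n. V i n * V i n))\<^sup>2"
        by (simp add: norm_mult power_mult_distrib)
      moreover have "c\<^sup>2 \<le> (cmod (\<Sum>n. V i n * V i n))\<^sup>2" using i c_pos by (intro power_mono) auto
      ultimately show "c\<^sup>2 * (cmod (a i))\<^sup>2 \<le> (cmod (\<Sum>n. f n * V i n))\<^sup>2"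
        by (simp add: mult.commute[of "c\<^sup>2"] mult_left_mono)
    qed
    also have "\<dots> \<le> C * (\<Sum>n. (cmod (f n))\<^sup>2)" by (intro dual_bessel S_fin SI f)
    finally show ?thesis using c_pos by (simp add: field_simps)
  qed
  moreover have "incseq \<sigma>"
    unfolding \<sigma>_def incseq_def by (intro allI impI sum_mono2 S_fin S_mono) auto
  ultimately have "convergent \<sigma>" by (meson incseq_convergent convergent_def)
  then have cau\<sigma>: "Cauchy \<sigma>" by (rule convergent_Cauchy)
  have diff: "(\<Sum>n. (cmod (g l n - g k n))\<^sup>2) \<le> C * (\<sigma> l - \<sigma> k)" if "k \<le> l" for k l
  proof -
    have "g l n - g k n = (\<Sum>i\<in>S l - S k. a i * V i n)" for n
      unfolding g_def using S_fin S_mono[OF that] by (subst sum_diff) auto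
    moreover have "\<sigma> l - \<sigma> k = (\<Sum>i\<in>S l - S k. (cmod (a i))\<^sup>2)"
      unfolding \<sigma>_def using S_fin S_mono[OF that] by (subst sum_diff) auto
    moreover have "finite (S l - S k)" "S l - S k \<subseteq> I" using S_fin SI by auto
    ultimately show ?thesis using bessel[of "S l - S k" a] by simp
  qed
  have "\<exists>K. \<forall>k\<ge>K. \<forall>l\<ge>k. (\<Sum>n. (cmod (g l n - g k n))\<^sup>2) \<le> e" if "e > 0" for e
  proof -
    obtain K where K: "\<And>m n. m \<ge> K \<Longrightarrow> n \<ge> K \<Longrightarrow> norm (\<sigma> m - \<sigma> n) < e / C"
      using CauchyD[OF cau\<sigma>, of "e / C"] \<open>e > 0\<close> C_pos by auto
    have "(\<Sum>n. (cmod (g l n - g k n))\<^sup>2) \<le> e" if "k \<ge> K" "l \<ge> k" for k l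
    proof -
      have "\<sigma> l - \<sigma> k \<le> e / C" using K[of l k] that by simp
      then have "C * (\<sigma> l - \<sigma> k) \<le> e" using C_pos by (simp add: field_simps)
      with diff[OF \<open>l \<ge> k\<close>] show ?thesis by linarith
    qed
    then show ?thesis by blast
  qed
  from complete_l2[OF gl2 this] obtain G where G: "summable (\<lambda>n. (cmod (G n))\<^sup>2)"
    and lim: "\<And>e. e > 0 \<Longrightarrow> \<exists>K. \<forall>k\<ge>K. (\<Sum>n. (cmod (G n - g k n))\<^sup>2) \<le> e" by blast
  have "(\<lambda>n. f n - G n) = (\<lambda>n. 0)"
  proof (rule total)
    show "summable (\<lambda>n. (cmod (f n - G n))\<^sup>2)" by (intro summable_diff_l2 f G)
    fix j assume j: "j \<in> I"
    \<comment> \<open>The added 1 only serves to make \<open>W\<close> a positive divisor.\<close>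
    define W where "W = (\<Sum>n. (cmod (V j n))\<^sup>2) + 1"
    have "(\<Sum>n. (cmod (V j n))\<^sup>2) \<ge> 0" by (intro suminf_nonneg l2 j) auto
    then have W: "(\<Sum>n. (cmod (V j n))\<^sup>2) \<le> W" "W > 0" by (auto simp: W_def)
    \<comment> \<open>As soon as j lies in \<open>S k\<close>, the vector f - g k pairs to zero with
      \<open>V j\<close>. Hence f - G pairs like g k - G, which tends to 0 in norm.\<close>
    have "(cmod (\<Sum>n. (f n - G n) * V j n))\<^sup>2 \<le> e" if "e > 0" for e
    proof -
      obtain K where K: "\<And>k. k \<ge> K \<Longrightarrow> (\<Sum>n. (cmod (G n - g k n))\<^sup>2) \<le> e / W"
        using lim[of "e / W"] \<open>e > 0\<close> W by auto
      obtain k0 where "j \<in> S k0" using j S_Un by auto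
      define k where "k = max K k0"
      have jk: "j \<in> S k" using \<open>j \<in> S k0\<close> S_mono[of k0 k] by (auto simp: k_def)
      have nz: "(\<Sum>n. V j n * V j n) \<noteq> 0" using diag[OF j] c_pos by auto
      have s: "summable (\<lambda>n. (f n - g k n) * V j n)" "summable (\<lambda>n. (G n - g k n) * V j n)"
        "summable (\<lambda>n. f n * V j n)" "summable (\<lambda>n. g k n * V j n)"
        by (intro summable_mult_l2 summable_diff_l2 f G gl2 l2 j)+
      have "(\<Sum>n. (f n - g k n) * V j n) = (\<Sum>n. f n * V j n) - (\<Sum>n. g k n * V j n)"
        using suminf_diff[OF s(3,4)] by (simp add: algebra_simps)
      also have "(\<Sum>n. g k n * V j n) = a j * (\<Sum>n. V j n * V j n)"
        unfolding g_def by (subst pairing_sum[OF S_fin SI j]) (simp add: jk)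
      also have "\<dots> = (\<Sum>n. f n * V j n)" using nz by (simp add: a_def)
      finally have z: "(\<Sum>n. (f n - g k n) * V j n) = 0" by simp
      have "(\<Sum>n. (f n - G n) * V j n) = (\<Sum>n. (f n - g k n) * V j n) - (\<Sum>n. (G n - g k n) * V j n)"
        by (subst suminf_diff[OF s(1,2)]) (simp add: algebra_simps)
      then have "(cmod (\<Sum>n. (f n - G n) * V j n))\<^sup>2 = (cmod (\<Sum>n. (G n - g k n) * V j n))\<^sup>2"
        using z by simp
      also have "\<dots> \<le> (\<Sum>n. (cmod (G n - g k n))\<^sup>2) * (\<Sum>n. (cmod (V j n))\<^sup>2)"
        by (intro Cauchy_Schwarz_l2 summable_diff_l2 G gl2 l2 j)
      also have "\<dots> \<le> e / W * W"
        using K[of k] W \<open>e > 0\<close> by (intro mult_mono suminf_nonneg l2 j) (auto simp: k_def)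
      finally show ?thesis using W by simp
    qed
    then have "(cmod (\<Sum>n. (f n - G n) * V j n))\<^sup>2 \<le> 0" by (rule dense_ge)
    then show "(\<Sum>n. (f n - G n) * V j n) = 0" by simp
  qed
  then have "G = f" by (simp add: fun_eq_iff)
  with lim[OF e] obtain K where "(\<Sum>n. (cmod (f n - g K n))\<^sup>2) \<le> e" by auto
  then show ?thesis unfolding g_def using S_fin SI by blast
qed

end

text \<open>Each entry is split as sqrt (k p) * sqrt (k / p) before Cauchy-Schwarz. The row
  hypothesis bounds the first factor by K q; after exchanging the sums, the column hypothesis
  absorbs this q and cancels the weight p.\<close>

lemma schur_test:
  fixes k :: "'i \<Rightarrow> 'j \<Rightarrow> real"
  assumes F: "finite F" and P: "finite P" and k: "\<And>w m. k w m \<ge> 0"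
    and p: "\<And>w. w \<in> F \<Longrightarrow> p w > 0" and q: "\<And>m. m \<in> P \<Longrightarrow> q m \<ge> 0" and "K \<ge> 0"
    and rows: "\<And>m. m \<in> P \<Longrightarrow> (\<Sum>w\<in>F. k w m * p w) \<le> K * q m"
    and cols: "\<And>w. w \<in> F \<Longrightarrow> (\<Sum>m\<in>P. k w m * q m) \<le> K * p w"
  shows "(\<Sum>m\<in>P. (\<Sum>w\<in>F. k w m * \<alpha> w)\<^sup>2) \<le> K\<^sup>2 * (\<Sum>w\<in>F. (\<alpha> w)\<^sup>2)"
proof -
  have "(\<Sum>m\<in>P. (\<Sum>w\<in>F. k w m * \<alpha> w)\<^sup>2)
      \<le> (\<Sum>m\<in>P. K * q m * (\<Sum>w\<in>F. k w m * ((\<alpha> w)\<^sup>2 / p w)))"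
  proof (rule sum_mono)
    fix m assume m: "m \<in> P"
    have "(\<Sum>w\<in>F. k w m * \<alpha> w)\<^sup>2 = (\<Sum>w\<in>F. sqrt (k w m * p w) * (sqrt (k w m / p w) * \<alpha> w))\<^sup>2"
    proof (intro arg_cong[where f = "\<lambda>x. x\<^sup>2"] sum.cong refl)
      fix w assume "w \<in> F"
      then have "sqrt (k w m * p w) * sqrt (k w m / p w) = k w m"
        using p k by (simp add: real_sqrt_mult[symmetric] less_imp_neq[symmetric])
      then show "k w m * \<alpha> w = sqrt (k w m * p w) * (sqrt (k w m / p w) * \<alpha> w)"
        by (metis mult.assoc)
    qed
    also have "\<dots> \<le> (\<Sum>w\<in>F. (sqrt (k w m * p w))\<^sup>2) * (\<Sum>w\<in>F. (sqrt (k w m / p w) * \<alpha> w)\<^sup>2)"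
      by (rule Cauchy_Schwarz_ineq_sum)
    also have "(\<Sum>w\<in>F. (sqrt (k w m * p w))\<^sup>2) = (\<Sum>w\<in>F. k w m * p w)"
      using k p by (intro sum.cong refl real_sqrt_pow2 mult_nonneg_nonneg) (auto intro: less_imp_le)
    also have "(\<Sum>w\<in>F. (sqrt (k w m / p w) * \<alpha> w)\<^sup>2) = (\<Sum>w\<in>F. k w m * ((\<alpha> w)\<^sup>2 / p w))"
      using k p by (intro sum.cong refl) (simp add: power_mult_distrib less_imp_le)
    also have "(\<Sum>w\<in>F. k w m * p w) * \<dots> \<le> K * q m * (\<Sum>w\<in>F. k w m * ((\<alpha> w)\<^sup>2 / p w))"
      using k p by (intro mult_right_mono rows m sum_nonneg mult_nonneg_nonneg divide_nonneg_nonneg)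
        (auto intro: less_imp_le)
    finally show "(\<Sum>w\<in>F. k w m * \<alpha> w)\<^sup>2 \<le> K * q m * (\<Sum>w\<in>F. k w m * ((\<alpha> w)\<^sup>2 / p w))" .
  qed
  also have "\<dots> = (\<Sum>m\<in>P. \<Sum>w\<in>F. K * ((\<alpha> w)\<^sup>2 / p w) * (k w m * q m))"
    by (simp add: sum_distrib_left mult_ac)
  also have "\<dots> = (\<Sum>w\<in>F. K * ((\<alpha> w)\<^sup>2 / p w) * (\<Sum>m\<in>P. k w m * q m))"
    by (subst sum.swap) (simp add: sum_distrib_left)
  also have "\<dots> \<le> (\<Sum>w\<in>F. K * ((\<alpha> w)\<^sup>2 / p w) * (K * p w))"
    using p \<open>K \<ge> 0\<close> by (intro sum_mono mult_left_mono cols mult_nonneg_nonneg divide_nonneg_nonneg)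
      (auto intro: less_imp_le)
  also have "\<dots> = (\<Sum>w\<in>F. K\<^sup>2 * (\<alpha> w)\<^sup>2)"
    using p by (intro sum.cong refl) (auto simp: power2_eq_square less_imp_neq[symmetric])
  finally show ?thesis by (simp add: sum_distrib_left)
qed

lemma norm_suminf_le_of_partial_sums:
  fixes f :: "nat \<Rightarrow> complex"
  assumes "\<And>N. (\<Sum>n<N. cmod (f n)) \<le> e"
  shows "summable (\<lambda>n. cmod (f n))" "cmod (suminf f) \<le> e"
proof -
  show s: "summable (\<lambda>n. cmod (f n))"
    by (rule summableI_nonneg_bounded[OF _ assms]) auto
  have "cmod (suminf f) \<le> (\<Sum>n. cmod (f n))" by (rule summable_norm[OF s])
  also have "\<dots> \<le> e" by (rule suminf_le_const[OF s assms])
  finally show "cmod (suminf f) \<le> e" .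
qed

text \<open>Arbitrary finite sets of indices are allowed because the blocks to which this is applied
  are selected by distance and need not be intervals.\<close>

lemma summable_finite_tail:
  fixes f :: "nat \<Rightarrow> real"
  assumes "summable f" "\<And>n. f n \<ge> 0" "e > 0"
  obtains M where "\<And>J. finite J \<Longrightarrow> J \<subseteq> {M..} \<Longrightarrow> sum f J \<le> e"
proof -
  obtain M where M: "\<And>m n. m \<ge> M \<Longrightarrow> norm (sum f {m..<n}) < e"
    using assms unfolding summable_Cauchy by blast
  have "sum f J \<le> e" if "finite J" "J \<subseteq> {M..}" for J
  proof -
    have "J \<subseteq> {M..<Suc (Max J)}" using that by (auto simp: less_Suc_eq_le)
    then have "sum f J \<le> sum f {M..<Suc (Max J)}" using assms by (intro sum_mono2) auto
    also have "\<dots> \<le> e" using M[of M "Suc (Max J)"] by simp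
    finally show ?thesis .
  qed
  then show thesis using that by blast
qed

text \<open>Here d n plays the role of C (|t n| + 1) powr (- N), and K is an integer bound for N.\<close>

locale small_cdb =
  fixes t :: "nat \<Rightarrow> complex" and \<mu> :: "nat \<Rightarrow> real" and A :: "complex \<Rightarrow> complex"
    and \<gamma> :: complex and d :: "nat \<Rightarrow> real" and c :: real and K :: nat
  assumes t_inf: "filterlim (\<lambda>n. cmod (t n)) at_top sequentially"
    and mu_pos: "\<And>n. \<mu> n > 0"
    and A_entire: "A holomorphic_on UNIV"
    and A_zeros: "\<And>z. A z = 0 \<longleftrightarrow> z \<in> range t"
    and A_simple: "\<And>n. deriv A (t n) \<noteq> 0"
    and small: "summable \<mu>"
    and gamma: "\<gamma> \<noteq> 0"
    and B_simple: "\<And>w. cdb_B t A \<mu> \<gamma> w = 0 \<Longrightarrow> deriv (cdb_B t A \<mu> \<gamma>) w \<noteq> 0"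
    and d_pos: "\<And>n. d n > 0" and d_le_1: "\<And>n. d n \<le> 1"
    and sep: "\<And>m n. m \<noteq> n \<Longrightarrow> d n \<le> dist (t n) (t m)"
    and c_pos: "c > 0" and d_ge: "\<And>n. c \<le> d n * (cmod (t n) + 1) ^ K"
    and mu_d: "(\<lambda>n. \<mu> n / (d n)\<^sup>2) \<longlonglongrightarrow> 0"
begin

section \<open>Sums over the points far from z\<close>

definition L :: real where "L = (\<Sum>n. \<mu> n)"

lemma L_pos: "L > 0"
  unfolding L_def by (intro suminf_pos small mu_pos)

lemma sum_mu_le: "finite J \<Longrightarrow> sum \<mu> J \<le> L"
  unfolding L_def by (intro sum_le_suminf small) (auto intro: less_imp_le mu_pos)

lemma t_eq_iff [simp]: "t m = t n \<longleftrightarrow> m = n"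
  using sep[of m n] d_pos[of n] by (metis dist_eq_0_iff not_less)

lemma near_unique:
  assumes "dist z (t m) < d m / 2" "dist z (t n) < d n / 2"
  shows "m = n"
proof (rule ccontr)
  assume "m \<noteq> n"
  then have "d m \<le> dist (t m) (t n)" "d n \<le> dist (t m) (t n)"
    using sep[of m n] sep[of n m] by (auto simp: dist_commute)
  moreover have "dist (t m) (t n) \<le> dist z (t m) + dist z (t n)"
    by (metis dist_commute dist_triangle)
  ultimately show False using assms by linarith
qed

text \<open>Three blocks receive \<open>e / 3\<close> each: finitely many initial indices, which z
  leaves behind as it grows; later points within distance 1; later points at distance at least 1.
  The statement speaks of finite sets so that it applies to partial sums and also to sums from which
  one exceptional index has been removed.\<close>

lemma sum_far_small:
  assumes "e > 0"
  shows "\<exists>R. \<forall>z J. R \<le> cmod z \<longrightarrow> finite J \<longrightarrow> (\<forall>m\<in>J. d m \<le> 2 * dist z (t m)) \<longrightarrow>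
      (\<Sum>m\<in>J. \<mu> m / dist z (t m)) \<le> e"
proof -
  obtain M1 where M1: "\<And>J. finite J \<Longrightarrow> J \<subseteq> {M1..} \<Longrightarrow> sum \<mu> J \<le> e / 3"
    using summable_finite_tail[OF small less_imp_le[OF mu_pos], of "e / 3"] assms by auto
  \<comment> \<open>The packing constant is 64, and 64 * (e / 192) = e / 3.\<close>
  obtain M2 where M2: "\<And>n. n \<ge> M2 \<Longrightarrow> norm (\<mu> n / (d n)\<^sup>2) < e / 192"
    using LIMSEQ_D[OF mu_d, of "e / 192"] assms by auto
  define M where "M = max M1 M2"
  \<comment> \<open>At distance at least \<open>r\<close> the initial block contributes at most L /
    r = e / 3; the choice of \<open>R\<close> keeps z that far from the first \<open>M\<close>
    points.\<close>
  define r where "r = 3 * L / e"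
  have r: "r > 0" using L_pos assms by (simp add: r_def)
  define R where "R = (\<Sum>m<M. cmod (t m)) + r"
  show ?thesis
  proof (intro exI[of _ R] allI impI)
    fix z J assume z: "R \<le> cmod z" and J: "finite J" and "\<forall>m\<in>J. d m \<le> 2 * dist z (t m)"
    then have far: "\<And>m. m \<in> J \<Longrightarrow> d m \<le> 2 * dist z (t m)" by blast
    define f where "f m = \<mu> m / dist z (t m)" for m
    have dp: "dist z (t m) > 0" if "m \<in> J" for m using far[OF that] d_pos[of m] by linarith
    define J1 where "J1 = J \<inter> {..<M}"
    define J2 where "J2 = {m \<in> J. m \<ge> M \<and> dist z (t m) < 1}"
    define J3 where "J3 = {m \<in> J. m \<ge> M \<and> dist z (t m) \<ge> 1}"
    have fin: "finite J1" "finite J2" "finite J3" using J by (auto simp: J1_def J2_def J3_def)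
    have "J = J1 \<union> (J2 \<union> J3)" by (auto simp: J1_def J2_def J3_def)
    moreover have "J1 \<inter> (J2 \<union> J3) = {}" "J2 \<inter> J3 = {}" by (auto simp: J1_def J2_def J3_def)
    ultimately have split: "sum f J = sum f J1 + (sum f J2 + sum f J3)"
      using fin by (simp add: sum.union_disjoint)
    have "sum f J1 \<le> (\<Sum>m\<in>J1. \<mu> m / r)"
    proof (rule sum_mono)
      fix m assume m: "m \<in> J1"
      then have "cmod (t m) \<le> (\<Sum>m<M. cmod (t m))" by (intro member_le_sum) (auto simp: J1_def)
      moreover have "cmod z \<le> dist z (t m) + cmod (t m)"
        by (metis dist_norm norm_triangle_sub add.commute)
      ultimately have "r \<le> dist z (t m)" using z unfolding R_def by linarith
      then show "f m \<le> \<mu> m / r"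
        unfolding f_def using r mu_pos[of m] by (intro divide_left_mono mult_pos_pos) auto
    qed
    also have "\<dots> = sum \<mu> J1 / r" by (simp add: sum_divide_distrib)
    also have "\<dots> \<le> L / r" using r sum_mu_le[OF fin(1)] by (intro divide_right_mono) auto
    also have "\<dots> = e / 3" using L_pos assms by (simp add: r_def)
    finally have 1: "sum f J1 \<le> e / 3" .
    have "sum f J2 \<le> (\<Sum>m\<in>J2. e / 192 * ((d m)\<^sup>2 / dist z (t m)))"
    proof (rule sum_mono)
      fix m assume m: "m \<in> J2"
      then have "\<mu> m / (d m)\<^sup>2 < e / 192" using M2[of m] mu_pos[of m] by (simp add: J2_def M_def)
      then have "\<mu> m \<le> e / 192 * (d m)\<^sup>2" using d_pos[of m] by (simp add: field_simps)
      then have "\<mu> m / dist z (t m) \<le> e / 192 * (d m)\<^sup>2 / dist z (t m)"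
        by (intro divide_right_mono) auto
      then show "f m \<le> e / 192 * ((d m)\<^sup>2 / dist z (t m))" by (simp add: f_def)
    qed
    also have "\<dots> = e / 192 * (\<Sum>m\<in>J2. (d m)\<^sup>2 / dist z (t m))" by (simp add: sum_distrib_left)
    also have "\<dots> \<le> e / 192 * 64"
    proof (intro mult_left_mono sum_separation_power2_div_dist_le)
      show "d m + d n \<le> 2 * dist (t m) (t n)" if "m \<noteq> n" for m n
        using sep[of m n] sep[of n m] that by (simp add: dist_commute)
    qed (use fin far assms d_pos in \<open>auto simp: J2_def\<close>)
    finally have 2: "sum f J2 \<le> e / 3" by simp
    have "sum f J3 \<le> sum \<mu> J3"
    proof (rule sum_mono)
      fix m assume "m \<in> J3"
      then have "1 \<le> dist z (t m)" by (simp add: J3_def)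
      then show "f m \<le> \<mu> m"
        unfolding f_def using divide_left_mono[of 1 "dist z (t m)" "\<mu> m"] mu_pos[of m] by fastforce
    qed
    also have "\<dots> \<le> e / 3" using fin by (intro M1) (auto simp: J3_def M_def)
    finally have 3: "sum f J3 \<le> e / 3" .
    show "(\<Sum>m\<in>J. \<mu> m / dist z (t m)) \<le> e" using 1 2 3 split by (simp add: f_def)
  qed
qed

text \<open>The reciprocals tend to 0. The bound also covers the case that z is one of the points,
  where the offending reciprocal has the value 0 by the convention for division.\<close>

lemma inverse_dist_bounded:
  obtains D where "\<And>n. 1 / dist z (t n) \<le> D"
proof -
  have "filterlim (\<lambda>n. dist z (t n)) at_top sequentially"
  proof (rule filterlim_at_top_mono)
    show "filterlim (\<lambda>n. - cmod z + cmod (t n)) at_top sequentially"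
      by (intro filterlim_tendsto_add_at_top[OF tendsto_const] t_inf)
    show "\<forall>\<^sub>F n in sequentially. - cmod z + cmod (t n) \<le> dist z (t n)"
      using norm_triangle_sub[of "t _" z]
      by (intro always_eventually allI) (simp add: dist_norm norm_minus_commute algebra_simps)
  qed
  then have "(\<lambda>n. inverse (dist z (t n))) \<longlonglongrightarrow> 0" by (rule tendsto_inverse_0_at_top)
  then have "Bseq (\<lambda>n. inverse (dist z (t n)))" by (intro convergent_imp_Bseq convergentI)
  then obtain D where "\<And>n. norm (inverse (dist z (t n))) \<le> D" unfolding Bseq_def by blast
  then show thesis using that[of D] by (simp add: divide_inverse)
qed

lemma summable_div_diff:
  assumes "summable (\<lambda>n. cmod (\<nu> n))"
  shows "summable (\<lambda>n. cmod (\<nu> n / (z - t n)))"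
proof -
  obtain D where D: "\<And>n. 1 / dist z (t n) \<le> D" using inverse_dist_bounded by blast
  show ?thesis
  proof (rule summable_comparison_test'[of _ 0])
    show "summable (\<lambda>n. cmod (\<nu> n) * D)" using assms by (rule summable_mult2)
    show "norm (cmod (\<nu> n / (z - t n))) \<le> cmod (\<nu> n) * D" for n
      using mult_left_mono[OF D[of n], of "cmod (\<nu> n)"] by (simp add: norm_divide dist_norm)
  qed
qed

subsection \<open>Entire functions in the space\<close>

abbreviation quot :: "nat \<Rightarrow> complex \<Rightarrow> complex" where "quot \<equiv> cdb_quot t A"

lemma A_t [simp]: "A (t n) = 0" using A_zeros by auto

lemma quot_at_t: "quot m (t n) = (if m = n then deriv A (t n) else 0)"
  by (simp add: cdb_quot_def)

lemma quot_off: "z \<notin> range t \<Longrightarrow> quot n z = A z / (z - t n)"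
  by (auto simp: cdb_quot_def)

lemma holomorphic_quot: "quot n holomorphic_on UNIV"
  by (rule pole_theorem_open_0[of A UNIV "t n"]) (auto simp: cdb_quot_def A_entire)

text \<open>Uniformity in n is the point: once |t n| \<ge> r + 1 the denominator has modulus at
  least 1 and the quotient is dominated by |A|, which leaves finitely many entire functions to be
  bounded on a compact disc.\<close>

lemma quot_bounded:
  "\<exists>Q. \<forall>n z. cmod z \<le> r \<longrightarrow> cmod (quot n z) \<le> Q"
proof -
  have bd: "\<exists>Q. \<forall>z. cmod z \<le> r \<longrightarrow> cmod (f z) \<le> Q" if "f holomorphic_on UNIV" for f :: "complex \<Rightarrow> complex"
  proof -
    have "compact (f ` cball 0 r)"
      using that by (intro compact_continuous_image) (auto intro: holomorphic_on_imp_continuous_on holomorphic_on_subset)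
    then have "bounded (f ` cball 0 r)" by (rule compact_imp_bounded)
    then show ?thesis unfolding bounded_iff by force
  qed
  obtain Q0 where Q0: "\<And>z. cmod z \<le> r \<Longrightarrow> cmod (A z) \<le> Q0" using bd[OF A_entire] by blast
  obtain q where q: "\<And>n z. cmod z \<le> r \<Longrightarrow> cmod (quot n z) \<le> q n" using bd[OF holomorphic_quot] by metis
  obtain M where M: "\<And>n. n \<ge> M \<Longrightarrow> cmod (t n) \<ge> r + 1"
    using t_inf unfolding filterlim_at_top eventually_sequentially by blast
  define Q where "Q = \<bar>Q0\<bar> + (\<Sum>n<M. \<bar>q n\<bar>) + 1"
  have nn: "(\<Sum>n<M. \<bar>q n\<bar>) \<ge> 0" by (intro sum_nonneg) auto
  show ?thesis
  proof (intro exI[of _ Q] allI impI)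
    fix n z assume z: "cmod z \<le> r"
    show "cmod (quot n z) \<le> Q"
    proof (cases "n < M")
      case True
      then have "\<bar>q n\<bar> \<le> (\<Sum>n<M. \<bar>q n\<bar>)" by (intro member_le_sum) auto
      then show ?thesis using q[OF z, of n] by (simp add: Q_def)
    next
      case False
      then have "r + 1 \<le> cmod (t n)" using M by auto
      moreover have "cmod (t n) \<le> cmod (z - t n) + cmod z"
        using norm_triangle_sub[of "t n" z] by (simp add: norm_minus_commute add.commute)
      ultimately have ge: "cmod (z - t n) \<ge> 1" using z by linarith
      then have "z \<noteq> t n" by auto
      then have "cmod (quot n z) = cmod (A z) / cmod (z - t n)" by (simp add: cdb_quot_def norm_divide)
      also have "\<dots> \<le> cmod (A z)" using ge by (simp add: divide_le_eq mult_left_le_one_le mult_le_cancel_left1)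
      also have "\<dots> \<le> Q" using Q0[OF z] nn unfolding Q_def by linarith
      finally show ?thesis .
    qed
  qed
qed

text \<open>The Cauchy transform of \<open>\<nu>\<close> multiplied by \<open>A\<close>, with the
  poles cancelled. Members of the space, the sum in \<open>B\<close>, and the quotient of
  \<open>B\<close> by a linear factor at a zero are all of this form.\<close>

definition ser :: "(nat \<Rightarrow> complex) \<Rightarrow> complex \<Rightarrow> complex" where
  "ser \<nu> z = (\<Sum>n. \<nu> n * quot n z)"

lemma summable_quot:
  assumes "summable (\<lambda>n. cmod (\<nu> n))"
  shows "summable (\<lambda>n. cmod (\<nu> n * quot n z))"
proof -
  obtain Q where Q: "\<And>n y. cmod y \<le> cmod z \<Longrightarrow> cmod (quot n y) \<le> Q"
    using quot_bounded[of "cmod z"] by blast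
  show ?thesis
  proof (rule summable_comparison_test'[of _ 0])
    show "summable (\<lambda>n. cmod (\<nu> n) * Q)" using assms by (rule summable_mult2)
    show "norm (cmod (\<nu> n * quot n z)) \<le> cmod (\<nu> n) * Q" for n
      using Q[of z n] by (simp add: norm_mult mult_left_mono)
  qed
qed

lemma holomorphic_ser:
  assumes "summable (\<lambda>n. cmod (\<nu> n))"
  shows "ser \<nu> holomorphic_on UNIV"
proof (rule holomorphic_uniform_sequence[where f = "\<lambda>N z. \<Sum>n<N. \<nu> n * quot n z"])
  show "(\<lambda>z. \<Sum>n<N. \<nu> n * quot n z) holomorphic_on UNIV" for N
    by (intro holomorphic_intros holomorphic_quot)
  fix x :: complex
  obtain Q where Q: "\<And>n y. cmod y \<le> cmod x + 1 \<Longrightarrow> cmod (quot n y) \<le> Q"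
    using quot_bounded[of "cmod x + 1"] by blast
  have "uniform_limit (cball x 1) (\<lambda>N z. \<Sum>n<N. \<nu> n * quot n z) (\<lambda>z. \<Sum>n. \<nu> n * quot n z) sequentially"
  proof (rule Weierstrass_m_test)
    show "summable (\<lambda>n. cmod (\<nu> n) * Q)" using assms by (rule summable_mult2)
    fix n z assume "z \<in> cball x 1"
    then have "cmod z \<le> cmod x + 1"
      using norm_triangle_sub[of z x] by (simp add: dist_norm norm_minus_commute)
    then show "norm (\<nu> n * quot n z) \<le> cmod (\<nu> n) * Q"
      using Q[of z n] by (simp add: norm_mult mult_left_mono)
  qed
  then show "\<exists>d>0. cball x d \<subseteq> UNIV \<and>
      uniform_limit (cball x d) (\<lambda>N z. \<Sum>n<N. \<nu> n * quot n z) (ser \<nu>) sequentially"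
    unfolding ser_def by (intro exI[of _ 1]) auto
qed simp

lemma ser_off:
  assumes "summable (\<lambda>n. cmod (\<nu> n))" "z \<notin> range t"
  shows "ser \<nu> z = A z * (\<Sum>n. \<nu> n / (z - t n))"
proof -
  have "summable (\<lambda>n. \<nu> n / (z - t n))"
    using summable_div_diff[OF assms(1)] by (rule summable_norm_cancel)
  from suminf_mult[OF this, of "A z"] show ?thesis
    unfolding ser_def by (simp add: quot_off[OF assms(2)] mult_ac)
qed

lemma ser_at_t: "ser \<nu> (t n) = \<nu> n * deriv A (t n)"
proof -
  have "ser \<nu> (t n) = (\<Sum>m. if m = n then \<nu> n * deriv A (t n) else 0)"
    unfolding ser_def by (intro suminf_cong) (simp add: quot_at_t)
  also have "\<dots> = \<nu> n * deriv A (t n)" by (subst suminf_finite[of "{n}"]) auto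
  finally show ?thesis .
qed

abbreviation B :: "complex \<Rightarrow> complex" where "B \<equiv> cdb_B t A \<mu> \<gamma>"

text \<open>The sign is opposite to that of the sum in the formula for B_gamma, so that zeros of
  \<open>B\<close> are solutions of \<phi> = \<gamma>.\<close>

definition \<phi> :: "complex \<Rightarrow> complex" where "\<phi> z = (\<Sum>n. complex_of_real (\<mu> n) / (z - t n))"

lemma mu_norm [simp]: "cmod (complex_of_real (\<mu> n)) = \<mu> n"
  using mu_pos[of n] by simp

lemma mu_nz [simp]: "\<mu> n \<noteq> 0" using mu_pos[of n] by simp

lemma summable_mu: "summable (\<lambda>n. cmod (complex_of_real (\<mu> n)))"
  unfolding mu_norm by (rule small)

lemma summable_phi: "summable (\<lambda>n. complex_of_real (\<mu> n) / (z - t n))"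
  using summable_div_diff[OF summable_mu] by (rule summable_norm_cancel)

lemma B_eq: "B z = \<gamma> * A z - ser (\<lambda>n. complex_of_real (\<mu> n)) z"
  by (simp add: cdb_B_def ser_def)

lemma holomorphic_B: "B holomorphic_on UNIV"
proof -
  have "(\<lambda>z. \<gamma> * A z - ser (\<lambda>n. complex_of_real (\<mu> n)) z) holomorphic_on UNIV"
    by (intro holomorphic_intros A_entire holomorphic_ser summable_mu)
  then show ?thesis by (simp add: B_eq[abs_def])
qed

lemma B_off: "z \<notin> range t \<Longrightarrow> B z = A z * (\<gamma> - \<phi> z)"
  using ser_off[OF summable_mu] by (simp add: B_eq \<phi>_def algebra_simps)

lemma B_at_t: "B (t n) = - complex_of_real (\<mu> n) * deriv A (t n)"
  by (simp add: B_eq ser_at_t)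

lemma zero_off: "B w = 0 \<Longrightarrow> w \<notin> range t"
  using B_at_t A_simple by auto

lemma zero_phi: "B w = 0 \<Longrightarrow> \<phi> w = \<gamma>"
  using B_off[OF zero_off] A_zeros zero_off by force

definition b :: "nat \<Rightarrow> real" where "b n = sqrt (\<mu> n)"

lemma b_pos: "b n > 0" using mu_pos by (simp add: b_def)

lemma b_sq: "b n * b n = \<mu> n" using mu_pos by (simp add: b_def less_imp_le)

definition v :: "complex \<Rightarrow> nat \<Rightarrow> complex" where "v w n = complex_of_real (b n) / (w - t n)"

lemma summable_b: "summable (\<lambda>n. (cmod (complex_of_real (b n)))\<^sup>2)"
  using small b_sq by (simp add: power2_eq_square)

lemma v_mult_v: "v w n * v w' n = complex_of_real (\<mu> n) / ((w - t n) * (w' - t n))"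
  by (simp add: v_def b_sq flip: of_real_mult)

lemma summable_v: "summable (\<lambda>n. (cmod (v w n))\<^sup>2)"
proof -
  obtain D where D: "\<And>n. 1 / dist w (t n) \<le> D" using inverse_dist_bounded by blast
  show ?thesis
  proof (rule summable_comparison_test'[of _ 0])
    show "summable (\<lambda>n. \<mu> n * D\<^sup>2)" using small by (rule summable_mult2)
    fix n
    have "(1 / dist w (t n))\<^sup>2 \<le> D\<^sup>2" using D by (intro power_mono) auto
    then have "\<mu> n * (1 / dist w (t n))\<^sup>2 \<le> \<mu> n * D\<^sup>2" using mu_pos[of n] by (intro mult_left_mono) auto
    then show "norm ((cmod (v w n))\<^sup>2) \<le> \<mu> n * D\<^sup>2"
      using b_sq[of n] mu_pos[of n]
      by (simp add: v_def norm_divide dist_norm power_divide power2_eq_square abs_of_pos)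
  qed
qed

text \<open>The difference of 1/(w - t n) and 1/(w' - t n) is (w' - w) times their product, so the
  pairing equals (\<phi> w - \<phi> w') / (w' - w); at zeros of \<open>B\<close> both values of
  \<open>\<phi>\<close> are \<open>\<gamma>\<close>.\<close>

lemma v_orthogonal:
  assumes "B w = 0" "B w' = 0" "w \<noteq> w'"
  shows "(\<Sum>n. v w n * v w' n) = 0"
proof -
  have "v w n * v w' n = (complex_of_real (\<mu> n) / (w - t n) - complex_of_real (\<mu> n) / (w' - t n)) / (w' - w)" for n
  proof -
    have "w - t n \<noteq> 0" "w' - t n \<noteq> 0" "w' - w \<noteq> 0" using assms zero_off by auto
    then show ?thesis unfolding v_mult_v by (simp add: divide_simps) (simp add: algebra_simps)
  qed
  then have "(\<Sum>n. v w n * v w' n) = (\<phi> w - \<phi> w') / (w' - w)"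
    unfolding \<phi>_def suminf_diff[OF summable_phi summable_phi]
    by (simp add: suminf_divide summable_diff summable_phi)
  then show ?thesis using assms by (simp add: zero_phi)
qed

lemma v_square_sum_nz:
  assumes w: "B w = 0"
  shows "(\<Sum>n. v w n * v w n) \<noteq> 0"
proof \<comment> \<open>the sum is deriv B w / A w, since B z = (z - w) ser \<nu> z\<close>
  assume z: "(\<Sum>n. v w n * v w n) = 0"
  define \<nu> where "\<nu> n = complex_of_real (\<mu> n) / (w - t n)" for n
  have \<nu>: "summable (\<lambda>n. cmod (\<nu> n))" unfolding \<nu>_def by (rule summable_div_diff[OF summable_mu])
  have woff: "w - t n \<noteq> 0" for n using zero_off[OF w] by auto
  have eq: "B z = (z - w) * ser \<nu> z" for z
  proof (cases "z \<in> range t")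
    case True
    then obtain n where "z = t n" by auto
    then show ?thesis using woff[of n] by (simp add: B_at_t ser_at_t \<nu>_def divide_simps) (simp add: algebra_simps)
  next
    case False
    have "complex_of_real (\<mu> n) / (w - t n) - complex_of_real (\<mu> n) / (z - t n) = (z - w) * (\<nu> n / (z - t n))" for n
    proof -
      have "z - t n \<noteq> 0" using False by auto
      then show ?thesis using woff[of n] unfolding \<nu>_def by (simp add: divide_simps) (simp add: algebra_simps)
    qed
    then have "\<phi> w - \<phi> z = (z - w) * (\<Sum>n. \<nu> n / (z - t n))"
      unfolding \<phi>_def suminf_diff[OF summable_phi summable_phi]
      using suminf_mult[OF summable_norm_cancel[OF summable_div_diff[OF \<nu>, of z]], of "z - w"] by simp
    then show ?thesis unfolding B_off[OF False] ser_off[OF \<nu> False] by (simp add: zero_phi[OF w])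
  qed
  have "ser \<nu> w = A w * (\<Sum>n. v w n * v w n)"
    by (simp add: ser_off[OF \<nu> zero_off[OF w]] v_mult_v \<nu>_def)
  then have "ser \<nu> w = 0" using z by simp
  obtain D where D: "(ser \<nu> has_field_derivative D) (at w)"
    using holomorphic_ser[OF \<nu>] by (auto simp: holomorphic_on_def field_differentiable_def)
  have "((\<lambda>z. (z - w) * ser \<nu> z) has_field_derivative 0) (at w)"
    by (rule derivative_eq_intros D refl | simp add: \<open>ser \<nu> w = 0\<close>)+
  then have "deriv B w = 0" using eq by (simp add: DERIV_imp_deriv eq[abs_def])
  then show False using B_simple[OF w] by simp
qed

end

lemma suminf_add_single:
  fixes f :: "nat \<Rightarrow> 'a::real_normed_vector"
  assumes "summable f"
  shows "(\<Sum>m. f m + (if m = n then x else 0)) = suminf f + x"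
  using sums_add[OF summable_sums[OF assms] sums_single[of n "\<lambda>_. x"]] by (rule sums_unique[symmetric])

context small_cdb
begin

subsection \<open>Localisation of the zeros and the Bessel bound\<close>

text \<open>The second clause says that the term at n alone accounts for half of
  \<open>\<gamma>\<close>, which makes entry n of \<open>v w\<close> large. The third says that this
  entry dominates: all other entries of a pairing add up to at most 4 L / (d n)^2, and 48 = 4 * 4 *
  3 makes this a third of the lower bound |\<gamma>|^2 / (4 mu n) for the peak.\<close>

definition localised :: "nat \<Rightarrow> complex \<Rightarrow> bool" where
  "localised n w \<longleftrightarrow> dist w (t n) < d n / 2 \<and> cmod \<gamma> / 2 \<le> \<mu> n / dist w (t n) \<and>
     48 * L * \<mu> n \<le> (cmod \<gamma>)\<^sup>2 * (d n)\<^sup>2"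

lemma phi_small_off:
  assumes "z \<notin> range t" "\<And>J. finite J \<Longrightarrow> (\<Sum>m\<in>J. \<mu> m / dist z (t m)) \<le> e"
  shows "cmod (\<phi> z) \<le> e"
  unfolding \<phi>_def
  by (rule norm_suminf_le_of_partial_sums(2)) (use assms(2) in \<open>simp add: norm_divide dist_norm abs_of_pos[OF mu_pos]\<close>)

text \<open>At a zero \<phi> w = \<gamma>, whereas far points supply at most half of |\<gamma>| once
  w is large. So some \<open>t n\<close> lies within \<open>d n / 2\<close>; there is only one such
  n, and its term must supply the other half.\<close>

lemma zero_localised:
  obtains R where "\<And>w. B w = 0 \<Longrightarrow> R \<le> cmod w \<Longrightarrow> \<exists>n. localised n w"
proof -
  have g0: "cmod \<gamma> > 0" using gamma by simp
  obtain R1 where R1: "\<forall>z J. R1 \<le> cmod z \<longrightarrow> finite J \<longrightarrow>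
      (\<forall>m\<in>J. d m \<le> 2 * dist z (t m)) \<longrightarrow> (\<Sum>m\<in>J. \<mu> m / dist z (t m)) \<le> cmod \<gamma> / 2"
    using sum_far_small[OF half_gt_zero[OF g0]] by blast
  define \<eta> where "\<eta> = (cmod \<gamma>)\<^sup>2 / (48 * L)"
  have "\<eta> > 0" using g0 L_pos by (simp add: \<eta>_def)
  then obtain M where M: "\<And>n. n \<ge> M \<Longrightarrow> norm (\<mu> n / (d n)\<^sup>2) < \<eta>"
    using LIMSEQ_D[OF mu_d, of \<eta>] by auto
  have mu_small: "48 * L * \<mu> n \<le> (cmod \<gamma>)\<^sup>2 * (d n)\<^sup>2" if "n \<ge> M" for n
  proof -
    have "\<mu> n / (d n)\<^sup>2 < \<eta>" using M[OF that] mu_pos[of n] by simp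
    then show ?thesis using d_pos[of n] L_pos by (simp add: \<eta>_def field_simps)
  qed
  \<comment> \<open>A zero within \<open>d n / 2\<close> < 1 of one of the first \<open>M\<close>
    points would be smaller than \<open>R\<close>. Thus n \<ge> M, and the third clause of
    \<open>localised\<close> is available.\<close>
  define R where "R = max R1 ((\<Sum>m<M. cmod (t m)) + 1)"
  have "\<exists>n. localised n w" if w: "B w = 0" and R: "R \<le> cmod w" for w
  proof -
    have wR1: "R1 \<le> cmod w" using R by (simp add: R_def)
    have "\<exists>n. dist w (t n) < d n / 2"
    proof (rule ccontr)
      assume "\<nexists>n. dist w (t n) < d n / 2"
      then have "d m / 2 \<le> dist w (t m)" for m by (meson not_less)
      then have "d m \<le> 2 * dist w (t m)" for m by (simp add: field_simps)
      then have "cmod (\<phi> w) \<le> cmod \<gamma> / 2"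
        using zero_off[OF w] wR1 R1 by (intro phi_small_off) auto
      then show False using zero_phi[OF w] g0 by simp
    qed
    then obtain n where n: "dist w (t n) < d n / 2" by blast
    have far: "d m \<le> 2 * dist w (t m)" if "m \<noteq> n" for m
      using near_unique[OF _ n, of m] that by (cases "dist w (t m) < d m / 2") auto
    have "n \<ge> M"
    proof (rule ccontr)
      assume "\<not> n \<ge> M"
      then have "cmod (t n) \<le> (\<Sum>m<M. cmod (t m))" by (intro member_le_sum) auto
      moreover have "cmod w \<le> dist w (t n) + cmod (t n)"
        by (metis dist_norm norm_triangle_sub add.commute)
      moreover have "dist w (t n) < 1" using n d_le_1[of n] d_pos[of n] by linarith
      ultimately show False using R unfolding R_def by linarith
    qed
    define f where "f m = (if m = n then 0 else complex_of_real (\<mu> m) / (w - t m))" for m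
    have "(\<Sum>m<N. cmod (f m)) \<le> cmod \<gamma> / 2" for N
    proof -
      have "(\<Sum>m<N. cmod (f m)) = (\<Sum>m\<in>{..<N} - {n}. \<mu> m / dist w (t m))"
        by (intro sum.mono_neutral_cong_right) (auto simp: f_def norm_divide dist_norm abs_of_pos[OF mu_pos])
      also have "\<dots> \<le> cmod \<gamma> / 2" using far wR1 R1 by auto
      finally show ?thesis .
    qed
    note f = norm_suminf_le_of_partial_sums[OF this]
    have "(\<lambda>m. complex_of_real (\<mu> m) / (w - t m)) = (\<lambda>m. f m + (if m = n then complex_of_real (\<mu> n) / (w - t n) else 0))"
      by (auto simp: f_def)
    then have "\<phi> w = suminf f + complex_of_real (\<mu> n) / (w - t n)"
      unfolding \<phi>_def using suminf_add_single[OF summable_norm_cancel[OF f(1)]] by simp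
    then have "\<gamma> = suminf f + complex_of_real (\<mu> n) / (w - t n)" by (simp add: zero_phi[OF w])
    then have "cmod \<gamma> \<le> cmod (suminf f) + \<mu> n / dist w (t n)"
      by (metis dist_norm mu_norm norm_divide norm_triangle_ineq)
    then have "cmod \<gamma> / 2 \<le> \<mu> n / dist w (t n)" using f(2) by linarith
    with n mu_small[OF \<open>n \<ge> M\<close>] show ?thesis by (auto simp: localised_def)
  qed
  then show thesis using that by blast
qed

text \<open>Replacing w by \<open>t n\<close> costs a factor 2, since |w - t n| < d n / 2 is at most
  half the distance from \<open>t n\<close> to any other point.\<close>

lemma dist_localised:
  assumes "localised n w" "m \<noteq> n"
  shows "dist (t n) (t m) \<le> 2 * dist w (t m)"
proof -
  have "dist (t n) (t m) \<le> dist w (t n) + dist w (t m)" by (metis dist_commute dist_triangle)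
  moreover have "dist w (t n) < d n / 2" using assms by (simp add: localised_def)
  ultimately show ?thesis using sep[OF assms(2)] by linarith
qed

lemma norm_v: "cmod (v w n) = b n / dist w (t n)"
  using b_pos[of n] by (simp add: v_def norm_divide dist_norm)

lemma norm_v_localised:
  assumes "localised n w"
  shows "cmod \<gamma> / (2 * b n) \<le> cmod (v w n)"
proof -
  have "cmod (v w n) = (\<mu> n / dist w (t n)) / b n"
    unfolding norm_v using b_pos[of n] by (simp add: b_sq[symmetric])
  moreover have "cmod \<gamma> / 2 / b n \<le> (\<mu> n / dist w (t n)) / b n"
    using assms b_pos[of n] by (intro divide_right_mono) (auto simp: localised_def less_imp_le)
  ultimately show ?thesis by (simp add: field_simps)
qed

lemma off_peak_pairing:
  assumes w: "localised n w" and w': "localised n w'"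
  defines "f \<equiv> (\<lambda>m. if m = n then 0 else v w m * v w' m)"
  shows "summable (\<lambda>m. cmod (f m))" "(\<Sum>m. cmod (f m)) \<le> cmod (v w n * v w' n) / 3"
proof -
  have p: "d n > 0" "L > 0" "b n > 0" "cmod \<gamma> > 0" using d_pos L_pos b_pos gamma by auto
  have part: "(\<Sum>m<N. cmod (f m)) \<le> cmod (v w n * v w' n) / 3" for N
  proof -
    have "(\<Sum>m<N. cmod (f m)) \<le> (\<Sum>m<N. \<mu> m * (4 / (d n)\<^sup>2))"
    proof (rule sum_mono)
      fix m
      show "cmod (f m) \<le> \<mu> m * (4 / (d n)\<^sup>2)"
      proof (cases "m = n")
        case True
        then show ?thesis using mu_pos[of m] by (simp add: f_def less_imp_le)
      next
        case False
        have a: "d n / 2 \<le> dist w (t m)" "d n / 2 \<le> dist w' (t m)"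
          using dist_localised[OF w False] dist_localised[OF w' False] sep[OF False] by auto
        have "cmod (f m) = \<mu> m / (dist w (t m) * dist w' (t m))"
          using False mu_pos[of m] by (simp add: f_def v_mult_v norm_divide norm_mult dist_norm)
        also have "\<dots> \<le> \<mu> m / (d n / 2 * (d n / 2))"
        proof -
          have "d n / 2 * (d n / 2) \<le> dist w (t m) * dist w' (t m)"
            using a p by (intro mult_mono) auto
          then show ?thesis using p mu_pos[of m] by (intro frac_le) auto
        qed
        also have "\<dots> = \<mu> m * (4 / (d n)\<^sup>2)" by (simp add: power2_eq_square)
        finally show ?thesis .
      qed
    qed
    also have "\<dots> = (\<Sum>m<N. \<mu> m) * (4 / (d n)\<^sup>2)" by (rule sum_distrib_right[symmetric])
    also have "\<dots> \<le> L * (4 / (d n)\<^sup>2)" by (intro mult_right_mono sum_mu_le) auto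
    also have "\<dots> \<le> (cmod \<gamma>)\<^sup>2 / (4 * \<mu> n) / 3"
    proof -
      have "48 * L * \<mu> n \<le> (cmod \<gamma>)\<^sup>2 * (d n)\<^sup>2" using w by (simp add: localised_def)
      then show ?thesis using p mu_pos[of n] by (simp add: field_simps)
    qed
    also have "(cmod \<gamma>)\<^sup>2 / (4 * \<mu> n) \<le> cmod (v w n * v w' n)"
    proof -
      have "(cmod \<gamma>)\<^sup>2 / (4 * \<mu> n) = cmod \<gamma> / (2 * b n) * (cmod \<gamma> / (2 * b n))"
        by (simp add: b_sq[symmetric] power2_eq_square)
      also have "\<dots> \<le> cmod (v w n) * cmod (v w' n)"
        using p norm_v_localised[OF w] norm_v_localised[OF w'] by (intro mult_mono) auto
      finally show ?thesis by (simp add: norm_mult)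
    qed
    finally show ?thesis by simp
  qed
  show "summable (\<lambda>m. cmod (f m))" by (rule norm_suminf_le_of_partial_sums(1)[OF part])
  then show "(\<Sum>m. cmod (f m)) \<le> cmod (v w n * v w' n) / 3" by (rule suminf_le_const[OF _ part])
qed

lemma v_peak_pos: "localised n w \<Longrightarrow> cmod (v w n) > 0"
proof -
  assume "localised n w"
  then have "cmod \<gamma> / (2 * b n) \<le> cmod (v w n)" by (rule norm_v_localised)
  moreover have "cmod \<gamma> / (2 * b n) > 0" using gamma b_pos by simp
  ultimately show ?thesis by linarith
qed

lemma peak_pairing:
  assumes w: "localised n w" and w': "localised n w'"
  shows "2 / 3 * cmod (v w n * v w' n) \<le> cmod (\<Sum>m. v w m * v w' m)"
proof -
  define f where "f m = (if m = n then 0 else v w m * v w' m)" for m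
  have f: "summable (\<lambda>m. cmod (f m))" "(\<Sum>m. cmod (f m)) \<le> cmod (v w n * v w' n) / 3"
    unfolding f_def by (rule off_peak_pairing[OF w w'])+
  have "(\<lambda>m. v w m * v w' m) = (\<lambda>m. f m + (if m = n then v w n * v w' n else 0))"
    by (auto simp: f_def)
  then have "(\<Sum>m. v w m * v w' m) = suminf f + v w n * v w' n"
    using suminf_add_single[OF summable_norm_cancel[OF f(1)]] by simp
  then have "v w n * v w' n = (\<Sum>m. v w m * v w' m) - suminf f" by simp
  then have "cmod (v w n * v w' n) \<le> cmod (\<Sum>m. v w m * v w' m) + cmod (suminf f)"
    by (metis norm_triangle_ineq4)
  moreover have "cmod (suminf f) \<le> cmod (v w n * v w' n) / 3"
    using summable_norm[OF f(1)] f(2) by linarith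
  ultimately show ?thesis by linarith
qed

text \<open>Orthogonality takes the place of a count of zeros: distinct zeros have vanishing
  pairing, but two vectors with a dominating entry in the same place do not.\<close>

lemma localised_inj:
  assumes "localised n w" "localised n w'" "B w = 0" "B w' = 0"
  shows "w = w'"
proof (rule ccontr)
  assume "w \<noteq> w'"
  then have "(\<Sum>m. v w m * v w' m) = 0" using assms v_orthogonal by blast
  then have "cmod (v w n * v w' n) \<le> 0" using peak_pairing[OF assms(1,2)] by simp
  then show False using v_peak_pos[OF assms(1)] v_peak_pos[OF assms(2)] by simp
qed

definition nrm :: "complex \<Rightarrow> real" where "nrm w = sqrt (\<Sum>n. (cmod (v w n))\<^sup>2)"

lemma nrm_sq: "(nrm w)\<^sup>2 = (\<Sum>n. (cmod (v w n))\<^sup>2)"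
  unfolding nrm_def by (intro real_sqrt_pow2 suminf_nonneg summable_v) auto

lemma norm_v_le_nrm: "cmod (v w n) \<le> nrm w"
  unfolding nrm_def using power2_le_suminf_l2[OF summable_v] by (rule real_le_rsqrt)

lemma nrm_pos: "w \<notin> range t \<Longrightarrow> nrm w > 0"
proof -
  assume "w \<notin> range t"
  then have "cmod (v w 0) > 0" unfolding norm_v using b_pos[of 0] by (intro divide_pos_pos) auto
  then show ?thesis using norm_v_le_nrm[of w 0] by linarith
qed

text \<open>The off-peak part is at most a third of the squared peak. Hence the squared norm is at
  most 4/3 and the bilinear square at least 2/3 of it, with ratio 1/2.\<close>

lemma nrm_localised:
  assumes w: "localised n w"
  shows "(nrm w)\<^sup>2 / 2 \<le> cmod (\<Sum>m. v w m * v w m)"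
proof -
  define f where "f m = (if m = n then 0 else v w m * v w m)" for m
  have f: "summable (\<lambda>m. cmod (f m))" "(\<Sum>m. cmod (f m)) \<le> cmod (v w n * v w n) / 3"
    unfolding f_def by (rule off_peak_pairing[OF w w])+
  have "(\<lambda>m. (cmod (v w m))\<^sup>2) = (\<lambda>m. cmod (f m) + (if m = n then (cmod (v w n))\<^sup>2 else 0))"
    by (auto simp: f_def norm_mult power2_eq_square)
  then have "(nrm w)\<^sup>2 = (\<Sum>m. cmod (f m)) + (cmod (v w n))\<^sup>2"
    unfolding nrm_sq using suminf_add_single[OF f(1)] by simp
  then have "(nrm w)\<^sup>2 \<le> 4 / 3 * (cmod (v w n))\<^sup>2"
    using f(2) by (simp add: norm_mult power2_eq_square)
  moreover have "2 / 3 * (cmod (v w n))\<^sup>2 \<le> cmod (\<Sum>m. v w m * v w m)"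
    using peak_pairing[OF w w] by (simp add: norm_mult power2_eq_square)
  ultimately show ?thesis by linarith
qed

definition V :: "complex \<Rightarrow> nat \<Rightarrow> complex" where "V w n = v w n / complex_of_real (nrm w)"

lemma summable_V: "summable (\<lambda>n. (cmod (V w n))\<^sup>2)"
  using summable_cmult_l2[OF summable_v, of "1 / complex_of_real (nrm w)"] by (simp add: V_def)

lemma V_norm: "w \<notin> range t \<Longrightarrow> (\<Sum>n. (cmod (V w n))\<^sup>2) = 1"
  using nrm_pos[of w] summable_v[of w]
  by (simp add: V_def norm_divide power_divide suminf_divide flip: nrm_sq)

lemma V_pairing: "(\<Sum>n. V w n * V w' n) = (\<Sum>n. v w n * v w' n) / complex_of_real (nrm w * nrm w')"
  using suminf_divide[OF summable_mult_l2[OF summable_v summable_v], of w w' "complex_of_real (nrm w * nrm w')"]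
  by (simp add: V_def)

text \<open>For large n the far estimate is applied at z = t n with the index n removed; for the
  finitely many remaining n, separation gives the crude bound L / d n.\<close>

lemma schur_bound:
  obtains K0 where "K0 \<ge> 0" "\<And>n J. finite J \<Longrightarrow> (\<Sum>m\<in>J. \<mu> m / dist (t n) (t m)) \<le> K0"
proof -
  obtain R where R: "\<forall>z J. R \<le> cmod z \<longrightarrow> finite J \<longrightarrow>
      (\<forall>m\<in>J. d m \<le> 2 * dist z (t m)) \<longrightarrow> (\<Sum>m\<in>J. \<mu> m / dist z (t m)) \<le> 1"
    using sum_far_small[OF zero_less_one] by blast
  obtain M where M: "\<And>n. n \<ge> M \<Longrightarrow> cmod (t n) \<ge> R"
    using t_inf unfolding filterlim_at_top eventually_sequentially by blast
  define K0 where "K0 = 1 + (\<Sum>n<M. L / d n)"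
  have nn: "(\<Sum>n<M. L / d n) \<ge> 0"
    using L_pos d_pos by (intro sum_nonneg divide_nonneg_nonneg) (auto intro: less_imp_le)
  have "(\<Sum>m\<in>J. \<mu> m / dist (t n) (t m)) \<le> K0" if J: "finite J" for n J
  proof -
    \<comment> \<open>The term m = n is a division by zero and has the value 0.\<close>
    have "(\<Sum>m\<in>J. \<mu> m / dist (t n) (t m)) = (\<Sum>m\<in>J - {n}. \<mu> m / dist (t n) (t m))"
      using J by (intro sum.mono_neutral_right) auto
    also have "\<dots> \<le> K0"
    proof (cases "n < M")
      case True
      have "(\<Sum>m\<in>J - {n}. \<mu> m / dist (t n) (t m)) \<le> (\<Sum>m\<in>J - {n}. \<mu> m / d n)"
      proof (rule sum_mono)
        fix m assume "m \<in> J - {n}"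
        then show "\<mu> m / dist (t n) (t m) \<le> \<mu> m / d n"
          using sep[of m n] d_pos[of n] mu_pos[of m] by (intro frac_le) auto
      qed
      also have "\<dots> = sum \<mu> (J - {n}) / d n" by (simp add: sum_divide_distrib)
      also have "\<dots> \<le> L / d n"
        using J d_pos[of n] by (intro divide_right_mono sum_mu_le) auto
      also have "\<dots> \<le> (\<Sum>n<M. L / d n)"
        using True L_pos d_pos by (intro member_le_sum divide_nonneg_nonneg) (auto intro: less_imp_le)
      finally show ?thesis by (simp add: K0_def)
    next
      case False
      have "d m \<le> 2 * dist (t n) (t m)" if "m \<in> J - {n}" for m
        using sep[of n m] that by (simp add: dist_commute) (use zero_le_dist[of "t m" "t n"] in linarith)
      then have "(\<Sum>m\<in>J - {n}. \<mu> m / dist (t n) (t m)) \<le> 1" using R M[of n] False J by auto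
      then show ?thesis using nn by (simp add: K0_def)
    qed
    finally show ?thesis .
  qed
  moreover have "K0 \<ge> 0" using nn by (simp add: K0_def)
  ultimately show thesis using that by blast
qed

text \<open>The norm is at least its peak |\<gamma>| / (2 b n), and off the peak |v w m| is at most
  2 b m / |t n - t m|. The result is a symmetric kernel in n and m that no longer involves w; at m =
  n its second summand is 0 by the convention for division.\<close>

lemma norm_V_localised:
  assumes w: "localised n w"
  shows "cmod (V w m) \<le> (if m = n then 1 else 0) + 4 / cmod \<gamma> * (b n * b m / dist (t n) (t m))"
proof -
  have np: "nrm w > 0" using v_peak_pos[OF w] norm_v_le_nrm[of w n] by linarith
  have V: "cmod (V w m) = cmod (v w m) / nrm w" using np by (simp add: V_def norm_divide)
  show ?thesis
  proof (cases "m = n")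
    case True
    then show ?thesis using V np norm_v_le_nrm[of w n] by simp
  next
    case False
    have g: "cmod \<gamma> > 0" "b n > 0" "b m > 0" using gamma b_pos by auto
    have D: "dist (t n) (t m) > 0" using False by auto
    have "cmod (v w m) \<le> b m / (dist (t n) (t m) / 2)"
      unfolding norm_v using dist_localised[OF w False] D g by (intro frac_le) auto
    moreover have "cmod \<gamma> / (2 * b n) \<le> nrm w"
      using norm_v_localised[OF w] norm_v_le_nrm[of w n] by linarith
    ultimately have "cmod (v w m) / nrm w \<le> b m / (dist (t n) (t m) / 2) / (cmod \<gamma> / (2 * b n))"
      using g D by (intro frac_le) auto
    also have "\<dots> = 4 / cmod \<gamma> * (b n * b m / dist (t n) (t m))" using g D by (simp add: field_simps)
    finally show ?thesis using V False by simp
  qed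
qed

text \<open>This is what singles out \<open>b\<close> as Schur weight: the extra factor b m
  completes b m * b m to mu m, and a factor b n remains in front of the sum bounded by
  \<open>K0\<close>.\<close>

lemma sum_b_dist_le:
  assumes "finite J" "(\<And>J. finite J \<Longrightarrow> (\<Sum>m\<in>J. \<mu> m / dist (t n) (t m)) \<le> K0)"
  shows "(\<Sum>m\<in>J. ((if m = n then 1 else 0) + 4 / cmod \<gamma> * (b n * b m / dist (t n) (t m))) * b m)
    \<le> (1 + 4 * K0 / cmod \<gamma>) * b n"
proof -
  have "(\<Sum>m\<in>J. ((if m = n then 1 else 0) + 4 / cmod \<gamma> * (b n * b m / dist (t n) (t m))) * b m)
    = (\<Sum>m\<in>J. (if m = n then b n else 0) + 4 / cmod \<gamma> * b n * (\<mu> m / dist (t n) (t m)))"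
    by (intro sum.cong refl) (auto simp: b_sq[symmetric] algebra_simps)
  also have "\<dots> = (\<Sum>m\<in>J. if m = n then b n else 0) + 4 / cmod \<gamma> * b n * (\<Sum>m\<in>J. \<mu> m / dist (t n) (t m))"
    by (simp add: sum.distrib sum_distrib_left)
  also have "\<dots> \<le> b n + 4 / cmod \<gamma> * b n * K0"
    using assms b_pos[of n] by (intro add_mono mult_left_mono) (auto simp: less_imp_le)
  also have "\<dots> = (1 + 4 * K0 / cmod \<gamma>) * b n" by (simp add: algebra_simps)
  finally show ?thesis .
qed

text \<open>Since distinct zeros have distinct peaks, sums over zeros become sums over indices. The
  kernel is symmetric, so the same estimate bounds rows and columns.\<close>

lemma bessel_localised:
  obtains C where "C > 0" "\<And>F a. finite F \<Longrightarrow> (\<And>w. w \<in> F \<Longrightarrow> B w = 0 \<and> (\<exists>n. localised n w)) \<Longrightarrow>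
    (\<Sum>n. (cmod (\<Sum>w\<in>F. a w * V w n))\<^sup>2) \<le> C * (\<Sum>w\<in>F. (cmod (a w))\<^sup>2)"
proof -
  obtain K0 where K0: "K0 \<ge> 0" "\<And>n J. finite J \<Longrightarrow> (\<Sum>m\<in>J. \<mu> m / dist (t n) (t m)) \<le> K0"
    using schur_bound by blast
  define K1 where "K1 = 1 + 4 * K0 / cmod \<gamma>"
  have K1: "K1 > 0" using K0 by (auto simp: K1_def intro: add_pos_nonneg)
  have "(\<Sum>n. (cmod (\<Sum>w\<in>F. a w * V w n))\<^sup>2) \<le> K1\<^sup>2 * (\<Sum>w\<in>F. (cmod (a w))\<^sup>2)"
    if F: "finite F" and loc: "\<And>w. w \<in> F \<Longrightarrow> B w = 0 \<and> (\<exists>n. localised n w)" for F and a :: "complex \<Rightarrow> complex"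
  proof -
    obtain N where N: "\<And>w. w \<in> F \<Longrightarrow> localised (N w) w" using loc by metis
    have inj: "inj_on N F" using N loc localised_inj unfolding inj_on_def by metis
    define k where "k w m = (if m = N w then 1 else 0) + 4 / cmod \<gamma> * (b (N w) * b m / dist (t (N w)) (t m))" for w m
    have k0: "k w m \<ge> 0" for w m
      unfolding k_def using b_pos[of "N w"] b_pos[of m]
      by (intro add_nonneg_nonneg mult_nonneg_nonneg divide_nonneg_nonneg) auto
    have "(\<Sum>m<P. (cmod (\<Sum>w\<in>F. a w * V w m))\<^sup>2) \<le> K1\<^sup>2 * (\<Sum>w\<in>F. (cmod (a w))\<^sup>2)" for P
    proof -
      have "(\<Sum>m<P. (cmod (\<Sum>w\<in>F. a w * V w m))\<^sup>2) \<le> (\<Sum>m<P. (\<Sum>w\<in>F. k w m * cmod (a w))\<^sup>2)"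
      proof (intro sum_mono power_mono)
        fix m
        have "cmod (\<Sum>w\<in>F. a w * V w m) \<le> (\<Sum>w\<in>F. cmod (a w * V w m))" by (rule norm_sum)
        also have "\<dots> \<le> (\<Sum>w\<in>F. k w m * cmod (a w))"
        proof (rule sum_mono)
          fix w assume "w \<in> F"
          then have "cmod (V w m) \<le> k w m" unfolding k_def by (intro norm_V_localised N)
          then show "cmod (a w * V w m) \<le> k w m * cmod (a w)"
            by (subst norm_mult, subst mult.commute) (rule mult_right_mono, auto)
        qed
        finally show "cmod (\<Sum>w\<in>F. a w * V w m) \<le> (\<Sum>w\<in>F. k w m * cmod (a w))" .
      qed simp
      also have "\<dots> \<le> K1\<^sup>2 * (\<Sum>w\<in>F. (cmod (a w))\<^sup>2)"
      proof (rule schur_test[where p = "\<lambda>w. b (N w)" and q = b])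
        show "(\<Sum>w\<in>F. k w m * b (N w)) \<le> K1 * b m" for m
        proof -
          have "(\<Sum>w\<in>F. k w m * b (N w))
            = (\<Sum>n\<in>N ` F. ((if n = m then 1 else 0) + 4 / cmod \<gamma> * (b m * b n / dist (t m) (t n))) * b n)"
            unfolding k_def by (subst sum.reindex[OF inj]) (auto intro!: sum.cong simp: dist_commute mult.commute)
          also have "\<dots> \<le> K1 * b m" unfolding K1_def using F K0 by (intro sum_b_dist_le) auto
          finally show ?thesis .
        qed
        show "(\<Sum>m<P. k w m * b m) \<le> K1 * b (N w)" for w
          unfolding k_def K1_def using K0 by (intro sum_b_dist_le) auto
      qed (use F k0 b_pos K1 in \<open>auto intro: less_imp_le\<close>)
      finally show ?thesis .
    qed
    then show ?thesis by (intro suminf_le_const summable_sum_l2 summable_V)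
  qed
  moreover have "K1\<^sup>2 > 0" using K1 by simp
  ultimately show thesis using that by blast
qed

lemma finite_zeros: "finite {w. cmod w \<le> R \<and> B w = 0}"
proof (cases "B constant_on UNIV")
  case True
  then have "B z = B (t 0)" for z unfolding constant_on_def by auto
  moreover have "B (t 0) \<noteq> 0" using A_simple[of 0] by (simp add: B_at_t)
  ultimately have "B z \<noteq> 0" for z by metis
  then show ?thesis by simp
next
  case False
  then have "finite {w \<in> cball 0 R. B w = 0}"
    by (intro holomorphic_compact_finite_zeros[OF holomorphic_B]) auto
  then show ?thesis by simp
qed

text \<open>The finitely many zeros that may fail to be localised are treated by Cauchy-Schwarz.
  Each contributes a unit vector, so their constant is \<open>card E\<close>; the factors 2 come
  from splitting the combination into two parts.\<close>

lemma bessel: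
  obtains C where "C > 0" "\<And>F a. finite F \<Longrightarrow> F \<subseteq> {w. B w = 0} \<Longrightarrow>
    (\<Sum>n. (cmod (\<Sum>w\<in>F. a w * V w n))\<^sup>2) \<le> C * (\<Sum>w\<in>F. (cmod (a w))\<^sup>2)"
proof -
  obtain R where R: "\<And>w. B w = 0 \<Longrightarrow> R \<le> cmod w \<Longrightarrow> \<exists>n. localised n w"
    using zero_localised by blast
  obtain C where C: "C > 0" "\<And>F a. finite F \<Longrightarrow> (\<And>w. w \<in> F \<Longrightarrow> B w = 0 \<and> (\<exists>n. localised n w)) \<Longrightarrow>
    (\<Sum>n. (cmod (\<Sum>w\<in>F. a w * V w n))\<^sup>2) \<le> C * (\<Sum>w\<in>F. (cmod (a w))\<^sup>2)"
    using bessel_localised by blast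
  define E where "E = {w. cmod w \<le> R \<and> B w = 0}"
  have finE: "finite E" unfolding E_def by (rule finite_zeros)
  have "(\<Sum>n. (cmod (\<Sum>w\<in>F. a w * V w n))\<^sup>2) \<le> (2 * card E + 2 * C) * (\<Sum>w\<in>F. (cmod (a w))\<^sup>2)"
    if F: "finite F" "F \<subseteq> {w. B w = 0}" for F and a :: "complex \<Rightarrow> complex"
  proof -
    define x where "x n = (\<Sum>w\<in>F \<inter> E. a w * V w n)" for n
    define y where "y n = (\<Sum>w\<in>F - E. a w * V w n)" for n
    define S where "S = (\<Sum>w\<in>F. (cmod (a w))\<^sup>2)"
    have sx: "summable (\<lambda>n. (cmod (x n))\<^sup>2)" and sy: "summable (\<lambda>n. (cmod (y n))\<^sup>2)"
      unfolding x_def y_def by (intro summable_sum_l2 summable_V)+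
    have "(\<Sum>n. (cmod (y n))\<^sup>2) \<le> C * (\<Sum>w\<in>F - E. (cmod (a w))\<^sup>2)"
      unfolding y_def using F R by (intro C(2)) (auto simp: E_def)
    also have "\<dots> \<le> C * S"
      unfolding S_def using F C(1) by (intro mult_left_mono sum_mono2) auto
    finally have y: "(\<Sum>n. (cmod (y n))\<^sup>2) \<le> C * S" .
    have "(cmod (x n))\<^sup>2 \<le> (\<Sum>w\<in>F \<inter> E. (cmod (a w))\<^sup>2) * (\<Sum>w\<in>F \<inter> E. (cmod (V w n))\<^sup>2)" for n
    proof -
      have "cmod (x n) \<le> (\<Sum>w\<in>F \<inter> E. cmod (a w) * cmod (V w n))"
        unfolding x_def using norm_sum[of "\<lambda>w. a w * V w n"] by (simp add: norm_mult)
      then have "(cmod (x n))\<^sup>2 \<le> (\<Sum>w\<in>F \<inter> E. cmod (a w) * cmod (V w n))\<^sup>2" by (intro power_mono) auto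
      also note Cauchy_Schwarz_ineq_sum
      finally show ?thesis .
    qed
    then have "(\<Sum>n. (cmod (x n))\<^sup>2)
      \<le> (\<Sum>n. (\<Sum>w\<in>F \<inter> E. (cmod (a w))\<^sup>2) * (\<Sum>w\<in>F \<inter> E. (cmod (V w n))\<^sup>2))"
      using sx by (intro suminf_le summable_mult summable_sum summable_V)
    also have "\<dots> = (\<Sum>w\<in>F \<inter> E. (cmod (a w))\<^sup>2) * (\<Sum>w\<in>F \<inter> E. \<Sum>n. (cmod (V w n))\<^sup>2)"
      by (subst suminf_mult) (auto intro!: summable_sum summable_V simp: suminf_sum summable_V)
    also have "(\<Sum>w\<in>F \<inter> E. \<Sum>n. (cmod (V w n))\<^sup>2) = (\<Sum>w\<in>F \<inter> E. 1)"
      by (intro sum.cong refl V_norm zero_off) (auto simp: E_def)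
    also have "(\<Sum>w\<in>F \<inter> E. (cmod (a w))\<^sup>2) * (\<Sum>w\<in>F \<inter> E. 1) \<le> S * card E"
      unfolding S_def using F finE by (intro mult_mono sum_mono2) (auto intro: card_mono sum_nonneg)
    finally have x: "(\<Sum>n. (cmod (x n))\<^sup>2) \<le> S * card E" .
    have "(\<Sum>w\<in>F. a w * V w n) = x n + y n" for n
      unfolding x_def y_def by (rule sum.Int_Diff[OF F(1)])
    then have "(\<Sum>n. (cmod (\<Sum>w\<in>F. a w * V w n))\<^sup>2) = (\<Sum>n. (cmod (x n + y n))\<^sup>2)" by simp
    also have "\<dots> \<le> (\<Sum>n. 2 * (cmod (x n))\<^sup>2 + 2 * (cmod (y n))\<^sup>2)"
      using sx sy by (intro suminf_le norm_add_power2_le summable_add_l2 summable_add summable_mult)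
    also have "\<dots> = 2 * (\<Sum>n. (cmod (x n))\<^sup>2) + 2 * (\<Sum>n. (cmod (y n))\<^sup>2)"
      using sx sy by (simp add: suminf_add[symmetric] suminf_mult summable_mult)
    also have "\<dots> \<le> (2 * card E + 2 * C) * S" using x y by (simp add: algebra_simps)
    finally show ?thesis unfolding S_def .
  qed
  moreover have "2 * card E + 2 * C > 0" using C by (auto intro: add_nonneg_pos)
  ultimately show thesis using that by blast
qed

lemma diagonal_bound:
  obtains c0 where "c0 > 0" "\<And>w. B w = 0 \<Longrightarrow> c0 \<le> cmod (\<Sum>n. V w n * V w n)"
proof -
  obtain R where R: "\<And>w. B w = 0 \<Longrightarrow> R \<le> cmod w \<Longrightarrow> \<exists>n. localised n w"
    using zero_localised by blast
  define E where "E = {w. cmod w \<le> R \<and> B w = 0}"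
  have finE: "finite E" unfolding E_def by (rule finite_zeros)
  \<comment> \<open>The inserted 1/2 is the bound for all localised zeros and keeps the minimum
    defined when \<open>E\<close> is empty.\<close>
  define c0 where "c0 = Min (insert (1/2) ((\<lambda>w. cmod (\<Sum>n. V w n * V w n)) ` E))"
  have pos: "cmod (\<Sum>n. V w n * V w n) > 0" if "B w = 0" for w
    using v_square_sum_nz[OF that] nrm_pos[OF zero_off[OF that]] by (simp add: V_pairing)
  have "c0 > 0" unfolding c0_def using finE pos by (auto simp: E_def)
  moreover have "c0 \<le> cmod (\<Sum>n. V w n * V w n)" if w: "B w = 0" for w
  proof (cases "w \<in> E")
    case True
    then show ?thesis unfolding c0_def using finE by (intro Min_le) auto
  next
    case False
    then obtain n where n: "localised n w" using R[OF w] w by (force simp: E_def)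
    have np: "nrm w > 0" using nrm_pos[OF zero_off[OF w]] .
    have "1 / 2 \<le> cmod (\<Sum>n. v w n * v w n) / (nrm w)\<^sup>2"
      using nrm_localised[OF n] np by (simp add: field_simps)
    also have "\<dots> = cmod (\<Sum>n. V w n * V w n)"
      using np by (simp add: V_pairing norm_divide norm_mult power2_eq_square)
    finally have "1 / 2 \<le> cmod (\<Sum>n. V w n * V w n)" .
    moreover have "c0 \<le> 1 / 2" unfolding c0_def using finE by (intro Min_le) auto
    ultimately show ?thesis by linarith
  qed
  ultimately show thesis using that by blast
qed

end

section \<open>Quotients of entire functions and growth of polynomials\<close>

lemma holomorphic_quotient_simple_zeros:
  assumes F: "F holomorphic_on UNIV" and G: "G holomorphic_on UNIV"
    and simple: "\<And>w. G w = 0 \<Longrightarrow> deriv G w \<noteq> 0" and zero: "\<And>w. G w = 0 \<Longrightarrow> F w = 0"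
  obtains h where "h holomorphic_on UNIV" "\<And>z. F z = h z * G z"
proof -
  \<comment> \<open>At a zero of \<open>G\<close> the value is the one given by l'Hospital's rule.
    It makes \<open>h\<close> continuous there, so the isolated singularity is removable.\<close>
  define h where "h z = (if G z = 0 then deriv F z / deriv G z else F z / G z)" for z
  have DF: "(F has_field_derivative deriv F z) (at z)" for z
    using F by (simp add: DERIV_deriv_iff_field_differentiable holomorphic_on_def)
  have DG: "(G has_field_derivative deriv G z) (at z)" for z
    using G by (simp add: DERIV_deriv_iff_field_differentiable holomorphic_on_def)
  have opn: "open (UNIV - {z. G z = 0})"
    using G by (intro open_Diff closed_Collect_eq holomorphic_on_imp_continuous_on) auto
  have "(\<lambda>z. F z / G z) holomorphic_on (UNIV - {z. G z = 0})"
    by (intro holomorphic_intros holomorphic_on_subset[OF F] holomorphic_on_subset[OF G]) auto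
  then have hol: "h holomorphic_on (UNIV - {z. G z = 0})"
    by (rule holomorphic_transform) (auto simp: h_def)
  have "h field_differentiable (at z)" for z
  proof (cases "G z = 0")
    case False
    then show ?thesis using hol opn by (simp add: holomorphic_on_open field_differentiable_def)
  next
    case True
    have lim: "(h \<longlongrightarrow> h z) (at z)" and ne: "eventually (\<lambda>y. G y \<noteq> 0) (at z)"
    proof -
      have "((\<lambda>y. (G y - G z) / (y - z)) \<longlongrightarrow> deriv G z) (at z)"
        using DG[of z] by (simp add: has_field_derivative_iff)
      then have "eventually (\<lambda>y. (G y - G z) / (y - z) \<noteq> 0) (at z)"
        using simple[OF True] by (rule tendsto_imp_eventually_ne)
      then show ne: "eventually (\<lambda>y. G y \<noteq> 0) (at z)"
        by eventually_elim (auto simp: True)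
      have "((\<lambda>y. F y / G y) \<longlongrightarrow> h z) (at z)"
        by (rule lhopital_complex_simple[OF DF DG zero[OF True] True simple[OF True]]) (simp add: h_def True)
      moreover have "eventually (\<lambda>y. F y / G y = h y) (at z)"
        using ne by eventually_elim (simp add: h_def)
      ultimately show "(h \<longlongrightarrow> h z) (at z)" by (rule Lim_transform_eventually)
    qed
    from ne obtain r where r: "r > 0" "\<And>y. y \<noteq> z \<Longrightarrow> dist y z < r \<Longrightarrow> G y \<noteq> 0"
      unfolding eventually_at by auto
    have "h holomorphic_on ball z r"
    proof (rule no_isolated_singularity'[where K = "{z}"])
      show "(h \<longlongrightarrow> h y) (at y within ball z r)" if "y \<in> {z}" for y
        using lim that by (auto intro: tendsto_within_subset)
      show "h holomorphic_on (ball z r - {z})"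
        using r by (intro holomorphic_on_subset[OF hol]) (auto simp: dist_commute)
    qed auto
    then show ?thesis using r(1) by (simp add: holomorphic_on_open field_differentiable_def)
  qed
  then have "h holomorphic_on UNIV" by (simp add: holomorphic_on_def)
  moreover have "F z = h z * G z" for z using zero by (simp add: h_def)
  ultimately show thesis using that by blast
qed

text \<open>The purpose is the doubling property: it lets h (t m) be compared with h z whenever |t
  m| \<le> 2 |z|. Here n is merely an upper bound for the degree, so the proof passes to the largest
  index k with a nonzero coefficient; for large z, |h z| lies between e |z|^k and 3 e |z|^k.\<close>

lemma polynomial_growth:
  fixes a :: "nat \<Rightarrow> complex"
  assumes h: "\<And>z. h z = (\<Sum>i\<le>n. a i * z ^ i)" and nz: "\<exists>i\<le>n. a i \<noteq> 0"
  obtains Q q R where "Q > 0" "q > 0" "\<And>z. R \<le> cmod z \<Longrightarrow> q \<le> cmod (h z)"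
    "\<And>z s. R \<le> cmod z \<Longrightarrow> cmod s \<le> 2 * cmod z \<Longrightarrow> cmod (h s) \<le> Q * cmod (h z)"
proof -
  define k where "k = Max {i. i \<le> n \<and> a i \<noteq> 0}"
  have "k \<in> {i. i \<le> n \<and> a i \<noteq> 0}" unfolding k_def using nz by (intro Max_in) auto
  then have k: "k \<le> n" "a k \<noteq> 0" by auto
  have above: "a i = 0" if "k < i" "i \<le> n" for i
  proof (rule ccontr)
    assume "a i \<noteq> 0"
    then have "i \<le> k" unfolding k_def using that by (intro Max_ge) auto
    then show False using that by simp
  qed
  have hk: "h z = (\<Sum>i<k. a i * z ^ i) + a k * z ^ k" for z
  proof -
    have "h z = (\<Sum>i\<le>k. a i * z ^ i)"
      unfolding h using k above by (intro sum.mono_neutral_right) auto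
    then show ?thesis by (simp add: lessThan_Suc_atMost[symmetric])
  qed
  define e where "e = cmod (a k) / 2"
  have e: "e > 0" using k by (simp add: e_def)
  have "\<exists>M. \<forall>z. M \<le> cmod z \<longrightarrow> cmod (\<Sum>i<k. a i * z ^ i) \<le> e * cmod z ^ k"
  proof (cases k)
    case 0
    then show ?thesis using e by auto
  next
    case (Suc j)
    then show ?thesis using polyfun_extremal_lemma[OF e, of a j] by (simp add: lessThan_Suc_atMost)
  qed
  then obtain M where M: "\<And>z. M \<le> cmod z \<Longrightarrow> cmod (\<Sum>i<k. a i * z ^ i) \<le> e * cmod z ^ k" by blast
  have lower: "e * cmod z ^ k \<le> cmod (h z)" if "M \<le> cmod z" for z
  proof -
    have "cmod (a k * z ^ k) \<le> cmod (h z) + cmod (\<Sum>i<k. a i * z ^ i)"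
      using norm_triangle_ineq4[of "h z" "\<Sum>i<k. a i * z ^ i"] hk[of z] by simp
    then show ?thesis using M[OF that] by (simp add: norm_mult norm_power e_def)
  qed
  have upper: "cmod (h z) \<le> 3 * e * cmod z ^ k" if "M \<le> cmod z" for z
  proof -
    have "cmod (h z) \<le> cmod (\<Sum>i<k. a i * z ^ i) + cmod (a k * z ^ k)"
      unfolding hk by (rule norm_triangle_ineq)
    then show ?thesis using M[OF that] by (simp add: norm_mult norm_power e_def)
  qed
  define H where "H = (\<Sum>i\<le>n. cmod (a i) * \<bar>M\<bar> ^ i)"
  have H0: "H \<ge> 0" unfolding H_def by (intro sum_nonneg) auto
  have inner: "cmod (h s) \<le> H" if "cmod s < M" for s
  proof -
    have "cmod (h s) \<le> (\<Sum>i\<le>n. cmod (a i) * cmod s ^ i)"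
      unfolding h using norm_sum[of "\<lambda>i. a i * s ^ i" "{..n}"] by (simp add: norm_mult norm_power)
    also have "\<dots> \<le> H" unfolding H_def using that by (intro sum_mono mult_left_mono power_mono) auto
    finally show ?thesis .
  qed
  define R where "R = max M 1"
  \<comment> \<open>The term 3 * 2^k serves large s; \<open>H / e\<close> serves s inside the disc
    of radius \<open>M\<close>, where only the bound \<open>H\<close> is available.\<close>
  define Q where "Q = 3 * 2 ^ k + H / e"
  have Q: "Q > 0" unfolding Q_def using H0 e by (intro add_pos_nonneg) auto
  have low_e: "e \<le> cmod (h z)" if "R \<le> cmod z" for z
  proof -
    have "e * 1 \<le> e * cmod z ^ k" using e that by (intro mult_left_mono one_le_power) (auto simp: R_def)
    then show ?thesis using lower[of z] that by (simp add: R_def)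
  qed
  have "cmod (h s) \<le> Q * cmod (h z)" if z: "R \<le> cmod z" and s: "cmod s \<le> 2 * cmod z" for z s
  proof (cases "M \<le> cmod s")
    case True
    have "cmod (h s) \<le> 3 * e * cmod s ^ k" by (rule upper[OF True])
    also have "\<dots> \<le> 3 * e * (2 * cmod z) ^ k" using e s by (intro mult_left_mono power_mono) auto
    also have "\<dots> = 3 * 2 ^ k * (e * cmod z ^ k)" by (simp add: power_mult_distrib)
    also have "\<dots> \<le> 3 * 2 ^ k * cmod (h z)" using z lower[of z] by (intro mult_left_mono) (auto simp: R_def)
    also have "\<dots> \<le> Q * cmod (h z)" unfolding Q_def using H0 e by (intro mult_right_mono) auto
    finally show ?thesis .
  next
    case False
    then have "cmod (h s) \<le> H" by (intro inner) auto
    also have "\<dots> = H / e * e" using e by simp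
    also have "\<dots> \<le> H / e * cmod (h z)" using H0 e low_e[OF z] by (intro mult_left_mono) auto
    also have "\<dots> \<le> Q * cmod (h z)" unfolding Q_def by (intro mult_right_mono) auto
    finally show ?thesis .
  qed
  then show thesis using that[OF Q e] low_e by blast
qed

context small_cdb
begin

subsection \<open>Completeness\<close>

text \<open>If |z - t n| < 1 then |t n| + 1 \<le> |z| + 2, so \<open>d n\<close> and with it |z - t
  n| cannot be smaller than a negative power of |z| + 2. The factor 1 + 2 / c also covers distances
  of at least 1.\<close>

lemma cauchy_sum_bound:
  assumes \<nu>: "summable (\<lambda>n. cmod (\<nu> n))" and far: "\<And>m. d m \<le> 2 * dist z (t m)"
  shows "cmod (\<Sum>n. \<nu> n / (z - t n)) \<le> (\<Sum>n. cmod (\<nu> n)) * ((1 + 2 / c) * (cmod z + 2) ^ K)"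
proof -
  define E where "E = (1 + 2 / c) * (cmod z + 2) ^ K"
  have p1: "(cmod z + 2) ^ K \<ge> 1" by (intro one_le_power) (use norm_ge_zero[of z] in linarith)
  have E: "1 \<le> E" "2 / c * (cmod z + 2) ^ K \<le> E"
    using p1 c_pos mult_mono[of 1 "1 + 2 / c" 1 "(cmod z + 2) ^ K"]
      mult_right_mono[of "2 / c" "1 + 2 / c" "(cmod z + 2) ^ K"] unfolding E_def by auto
  have inv: "1 / dist z (t n) \<le> E" for n
  proof (cases "dist z (t n) \<ge> 1")
    case True
    then have "1 / dist z (t n) \<le> 1" by (subst divide_le_eq_1) auto
    then show ?thesis using E by linarith
  next
    case False
    have "cmod (t n) \<le> cmod z + dist z (t n)"
      by (metis dist_norm norm_triangle_sub norm_minus_commute)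
    then have tn: "cmod (t n) + 1 \<le> cmod z + 2" using False by linarith
    have dp: "dist z (t n) > 0" using far[of n] d_pos[of n] by linarith
    have "c \<le> d n * (cmod (t n) + 1) ^ K" by (rule d_ge)
    also have "\<dots> \<le> (2 * dist z (t n)) * (cmod z + 2) ^ K"
      using far d_pos[of n] tn by (intro mult_mono power_mono) (auto simp: less_imp_le)
    finally have "1 / dist z (t n) \<le> 2 / c * (cmod z + 2) ^ K"
      using c_pos dp by (simp add: field_simps)
    then show ?thesis using E by linarith
  qed
  have "(\<Sum>n<N. cmod (\<nu> n / (z - t n))) \<le> (\<Sum>n. cmod (\<nu> n)) * E" for N
  proof -
    have "(\<Sum>n<N. cmod (\<nu> n / (z - t n))) \<le> (\<Sum>n<N. cmod (\<nu> n) * E)"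
    proof (rule sum_mono)
      fix n
      show "cmod (\<nu> n / (z - t n)) \<le> cmod (\<nu> n) * E"
        using mult_left_mono[OF inv[of n], of "cmod (\<nu> n)"] by (simp add: norm_divide dist_norm)
    qed
    also have "\<dots> = (\<Sum>n<N. cmod (\<nu> n)) * E" by (simp add: sum_distrib_right)
    also have "\<dots> \<le> (\<Sum>n. cmod (\<nu> n)) * E"
      using E by (intro mult_right_mono sum_le_suminf \<nu>) auto
    finally show ?thesis .
  qed
  from norm_suminf_le_of_partial_sums(2)[OF this] show ?thesis by (simp add: E_def)
qed

lemma far_off: "(\<And>m. d m \<le> 2 * dist z (t m)) \<Longrightarrow> z \<notin> range t"
proof
  assume far: "\<And>m. d m \<le> 2 * dist z (t m)" and "z \<in> range t"
  then obtain n where "z = t n" by auto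
  then show False using far[of n] d_pos[of n] by simp
qed

text \<open>Circles of radius \<open>d n / 2\<close> play two roles: they are the boundaries for the
  maximum principle, and they supply arbitrarily large points at which the far estimates
  hold.\<close>

lemma sphere_far:
  assumes "dist z (t n) = d n / 2"
  shows "d m \<le> 2 * dist z (t m)"
proof (cases "m = n")
  case False
  have "d m \<le> dist (t m) (t n)" "d n \<le> dist (t m) (t n)"
    using sep[of m n] sep[of n m] False by (auto simp: dist_commute)
  moreover have "dist (t m) (t n) \<le> dist z (t m) + dist z (t n)"
    by (metis dist_commute dist_triangle)
  ultimately show ?thesis using assms by linarith
qed (use assms in simp)

text \<open>The annihilating sequence is encoded by the quotient \<open>h\<close>: evaluation at
  \<open>t n\<close> returns \<nu> n as -h (t n) * mu n. The Cauchy sum of \<open>\<nu>\<close>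
  equals h * (\<gamma> - \<phi>), of size at least |h| |\<gamma>| / 2 at far points. For a nonzero
  polynomial \<open>h\<close> the sum is too small for that: terms with |t m| \<le> 2 |z| give a
  small multiple of |h z|, the others at most N1 / |z|.\<close>

lemma v_total:
  assumes f: "summable (\<lambda>n. (cmod (f n))\<^sup>2)"
    and ann: "\<And>w. B w = 0 \<Longrightarrow> (\<Sum>n. f n * v w n) = 0"
  shows "f = (\<lambda>n. 0)"
proof -
  have g0: "cmod \<gamma> > 0" using gamma by simp
  define \<nu> where "\<nu> n = f n * complex_of_real (b n)" for n
  have \<nu>: "summable (\<lambda>n. cmod (\<nu> n))"
    unfolding \<nu>_def by (intro summable_norm_mult_l2 f summable_b)
  define N1 where "N1 = (\<Sum>n. cmod (\<nu> n))"
  have N1: "N1 \<ge> 0" unfolding N1_def by (intro suminf_nonneg \<nu>) auto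
  have "ser \<nu> w = 0" if "B w = 0" for w
    using ann[OF that] by (simp add: ser_off[OF \<nu> zero_off[OF that]] \<nu>_def v_def)
  then obtain h where h: "h holomorphic_on UNIV" and eq: "\<And>z. ser \<nu> z = h z * B z"
    using holomorphic_quotient_simple_zeros[OF holomorphic_ser[OF \<nu>] holomorphic_B B_simple] by metis
  have \<nu>_eq: "\<nu> n = - h (t n) * complex_of_real (\<mu> n)" for n
  proof -
    have "\<nu> n * deriv A (t n) = (- h (t n) * complex_of_real (\<mu> n)) * deriv A (t n)"
      using eq[of "t n"] by (simp add: ser_at_t B_at_t)
    then show ?thesis using A_simple[of n] by (simp only: mult_cancel_right) simp
  qed
  have off: "(\<Sum>n. \<nu> n / (z - t n)) = h z * (\<gamma> - \<phi> z)" if "z \<notin> range t" for z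
    using eq[of z] A_zeros[of z] that by (simp add: ser_off[OF \<nu> that] B_off[OF that])
  obtain R where R: "\<forall>z J. R \<le> cmod z \<longrightarrow> finite J \<longrightarrow>
      (\<forall>m\<in>J. d m \<le> 2 * dist z (t m)) \<longrightarrow> (\<Sum>m\<in>J. \<mu> m / dist z (t m)) \<le> cmod \<gamma> / 2"
    using sum_far_small[OF half_gt_zero[OF g0]] by blast
  have big: "cmod (h z) * (cmod \<gamma> / 2) \<le> cmod (\<Sum>n. \<nu> n / (z - t n))"
    if z: "R \<le> cmod z" and far: "\<And>m. d m \<le> 2 * dist z (t m)" for z
  proof -
    have zoff: "z \<notin> range t" by (rule far_off[OF far])
    have "cmod (\<phi> z) \<le> cmod \<gamma> / 2" using zoff z far R by (intro phi_small_off) auto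
    then have "cmod \<gamma> / 2 \<le> cmod (\<gamma> - \<phi> z)" using norm_triangle_ineq2[of \<gamma> "\<phi> z"] by linarith
    then show ?thesis unfolding off[OF zoff] norm_mult by (intro mult_left_mono) auto
  qed
  define H0 where "H0 = N1 * (1 + 2 / c) / (cmod \<gamma> / 2)"
  have H0: "H0 \<ge> 0" unfolding H0_def using N1 c_pos by auto
  have far_bound: "cmod (h z) \<le> H0 * (cmod z + 2) ^ K"
    if z: "R \<le> cmod z" and far: "\<And>m. d m \<le> 2 * dist z (t m)" for z
  proof -
    have "cmod (h z) * (cmod \<gamma> / 2) \<le> N1 * ((1 + 2 / c) * (cmod z + 2) ^ K)"
      using big[OF z far] cauchy_sum_bound[OF \<nu> far] unfolding N1_def by linarith
    then have "cmod (h z) \<le> N1 * ((1 + 2 / c) * (cmod z + 2) ^ K) / (cmod \<gamma> / 2)"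
      using g0 by (subst pos_le_divide_eq) auto
    then show ?thesis by (simp only: H0_def times_divide_eq_left mult.assoc)
  qed
  have growth: "cmod (h z) \<le> (H0 * 4 ^ K) * cmod z ^ K" if z: "max R 0 + 1 \<le> cmod z" for z
  proof -
    have z1: "1 \<le> cmod z" "R + 1 \<le> cmod z" using z by auto
    have "cmod (h z) \<le> H0 * (cmod z + 3) ^ K"
    proof (cases "\<exists>n. dist z (t n) < d n / 2")
      case False
      then have "d m / 2 \<le> dist z (t m)" for m by (meson not_less)
      then have far: "d m \<le> 2 * dist z (t m)" for m by (simp add: field_simps)
      have "cmod (h z) \<le> H0 * (cmod z + 2) ^ K" using z1 far by (intro far_bound) auto
      also have "\<dots> \<le> H0 * (cmod z + 3) ^ K" using H0 by (intro mult_left_mono power_mono) auto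
      finally show ?thesis .
    next
      case True
      then obtain n where n: "dist z (t n) < d n / 2" by blast
      \<comment> \<open>Inside this disc the Cauchy sum is not controlled, so the bound is taken
        from the boundary circle. Its points differ from z by at most 1 in modulus, which turns the
        2 of \<open>far_bound\<close> into 3; |z| \<ge> 1 later turns |z| + 3 into 4 |z|.\<close>
      show ?thesis
      proof (rule maximum_modulus_frontier[where f = h and \<xi> = z and S = "cball (t n) (d n / 2)"])
        show "h holomorphic_on interior (cball (t n) (d n / 2))" using h by (rule holomorphic_on_subset) auto
        show "continuous_on (closure (cball (t n) (d n / 2))) h"
          by (intro holomorphic_on_imp_continuous_on holomorphic_on_subset[OF h]) auto
        show "bounded (cball (t n) (d n / 2))" by simp
        show "z \<in> cball (t n) (d n / 2)" using n by (simp add: dist_commute)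
        fix y assume "y \<in> frontier (cball (t n) (d n / 2))"
        then have y: "dist y (t n) = d n / 2" using d_pos[of n] by (simp add: dist_commute)
        have "dist y z \<le> dist y (t n) + dist z (t n)" by (metis dist_commute dist_triangle)
        then have yz: "dist y z \<le> 1" using y n d_le_1[of n] by linarith
        have "cmod y \<le> cmod z + dist y z" "cmod z \<le> cmod y + dist y z"
          by (metis dist_norm norm_triangle_sub norm_minus_commute)+
        then have y3: "cmod y + 2 \<le> cmod z + 3" "R \<le> cmod y" using yz z1 by linarith+
        have "cmod (h y) \<le> H0 * (cmod y + 2) ^ K" using y3 sphere_far[OF y] by (intro far_bound) auto
        also have "\<dots> \<le> H0 * (cmod z + 3) ^ K" using H0 y3 by (intro mult_left_mono power_mono) auto
        finally show "cmod (h y) \<le> H0 * (cmod z + 3) ^ K" .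
      qed
    qed
    also have "\<dots> \<le> H0 * (4 * cmod z) ^ K" using H0 z1 by (intro mult_left_mono power_mono) auto
    finally show ?thesis by (simp add: power_mult_distrib mult_ac)
  qed
  define a where "a i = (deriv ^^ i) h 0 / fact i" for i
  have h_poly: "h z = (\<Sum>i\<le>K. a i * z ^ i)" for z
    using Liouville_polynomial[OF h growth] unfolding a_def by blast
  have "\<forall>i\<le>K. a i = 0"
  proof (rule ccontr)
    assume "\<not> (\<forall>i\<le>K. a i = 0)"
    then obtain Q q R' where Q: "Q > 0" "q > 0" and low: "\<And>z. R' \<le> cmod z \<Longrightarrow> q \<le> cmod (h z)"
      and dom: "\<And>z s. R' \<le> cmod z \<Longrightarrow> cmod s \<le> 2 * cmod z \<Longrightarrow> cmod (h s) \<le> Q * cmod (h z)"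
      using polynomial_growth[OF h_poly] by (metis (no_types, lifting))
    \<comment> \<open>With this choice Q |h z| e = |h z| |\<gamma>| / 4, half of the lower bound
      from \<open>big\<close>.\<close>
    define e where "e = cmod \<gamma> / (4 * Q)"
    have e: "e > 0" using g0 Q by (simp add: e_def)
    obtain R2 where R2: "\<forall>z J. R2 \<le> cmod z \<longrightarrow> finite J \<longrightarrow>
      (\<forall>m\<in>J. d m \<le> 2 * dist z (t m)) \<longrightarrow> (\<Sum>m\<in>J. \<mu> m / dist z (t m)) \<le> e"
      using sum_far_small[OF e] by blast
    \<comment> \<open>The last entry exceeds by 1 the bound on |z| that a nonzero \<open>h\<close>
      will turn out to impose.\<close>
    define X where "X = max (max R R') (max R2 (4 * N1 / (cmod \<gamma> * q) + 1))"
    obtain n where n: "cmod (t n) \<ge> X + 1"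
      using t_inf unfolding filterlim_at_top eventually_sequentially by blast
    define z where "z = t n + complex_of_real (d n / 2)"
    have "dist z (t n) = d n / 2" using d_pos[of n] by (simp add: z_def dist_norm)
    note far = sphere_far[OF this]
    have "cmod (t n) \<le> cmod z + dist z (t n)"
      by (metis dist_norm norm_triangle_sub norm_minus_commute)
    then have zX: "X \<le> cmod z" using n \<open>dist z (t n) = d n / 2\<close> d_le_1[of n] d_pos[of n] by linarith
    then have z: "R \<le> cmod z" "R' \<le> cmod z" "R2 \<le> cmod z" "4 * N1 / (cmod \<gamma> * q) + 1 \<le> cmod z"
      by (auto simp: X_def)
    have "4 * N1 / (cmod \<gamma> * q) \<ge> 0" using N1 Q by auto
    then have zp: "cmod z > 0" using z(4) by linarith
    have "(\<Sum>m<M. cmod (\<nu> m / (z - t m))) \<le> Q * cmod (h z) * e + N1 / cmod z" for M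
    proof -
      have "(\<Sum>m<M. cmod (\<nu> m / (z - t m)))
        \<le> (\<Sum>m<M. Q * cmod (h z) * (\<mu> m / dist z (t m)) + cmod (\<nu> m) / cmod z)"
      proof (rule sum_mono)
        fix m
        show "cmod (\<nu> m / (z - t m)) \<le> Q * cmod (h z) * (\<mu> m / dist z (t m)) + cmod (\<nu> m) / cmod z"
        proof (cases "cmod (t m) \<le> 2 * cmod z")
          case True
          have "cmod (\<nu> m / (z - t m)) = cmod (h (t m)) * (\<mu> m / dist z (t m))"
            by (simp add: \<nu>_eq norm_divide norm_mult dist_norm abs_of_pos[OF mu_pos])
          also have "\<dots> \<le> Q * cmod (h z) * (\<mu> m / dist z (t m))"
            using mu_pos[of m] by (intro mult_right_mono dom z True) (auto simp: less_imp_le)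
          finally show ?thesis using divide_nonneg_pos[OF norm_ge_zero zp, of "\<nu> m"] by linarith
        next
          case False
          have "cmod (t m) \<le> cmod z + dist z (t m)"
            by (metis dist_norm norm_triangle_sub norm_minus_commute)
          then have "cmod z \<le> dist z (t m)" using False by linarith
          then have "cmod (\<nu> m) / dist z (t m) \<le> cmod (\<nu> m) / cmod z" using zp by (intro frac_le) auto
          moreover have "0 \<le> Q * cmod (h z) * (\<mu> m / dist z (t m))"
            using Q mu_pos[of m] by (intro mult_nonneg_nonneg divide_nonneg_nonneg) (auto simp: less_imp_le)
          ultimately show ?thesis by (simp add: norm_divide dist_norm)
        qed
      qed
      also have "\<dots> = Q * cmod (h z) * (\<Sum>m<M. \<mu> m / dist z (t m)) + (\<Sum>m<M. cmod (\<nu> m)) / cmod z"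
        by (simp add: sum.distrib sum_distrib_left sum_divide_distrib)
      also have "\<dots> \<le> Q * cmod (h z) * e + N1 / cmod z"
      proof (intro add_mono mult_left_mono divide_right_mono)
        show "(\<Sum>m<M. \<mu> m / dist z (t m)) \<le> e" using R2 z(3) far by auto
        show "(\<Sum>m<M. cmod (\<nu> m)) \<le> N1" unfolding N1_def by (intro sum_le_suminf \<nu>) auto
      qed (use Q in auto)
      finally show ?thesis .
    qed
    from norm_suminf_le_of_partial_sums(2)[OF this] big[OF z(1) far]
    have "cmod (h z) * (cmod \<gamma> / 2) \<le> Q * cmod (h z) * e + N1 / cmod z" by linarith
    also have "Q * cmod (h z) * e = cmod (h z) * (cmod \<gamma> / 4)" using Q by (simp add: e_def)
    finally have "cmod (h z) * (cmod \<gamma> / 4) \<le> N1 / cmod z" by (simp add: field_simps)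
    moreover have "q * (cmod \<gamma> / 4) \<le> cmod (h z) * (cmod \<gamma> / 4)"
      by (intro mult_right_mono low z) auto
    ultimately have "q * (cmod \<gamma> / 4) \<le> N1 / cmod z" by linarith
    then have "cmod z \<le> 4 * N1 / (cmod \<gamma> * q)" using zp g0 Q by (simp add: field_simps)
    then show False using z(4) by linarith
  qed
  then have "h z = 0" for z unfolding h_poly by (intro sum.neutral) auto
  then have "\<nu> n = 0" for n by (simp add: \<nu>_eq)
  then have "f n = 0" for n using b_pos[of n] unfolding \<nu>_def by (metis less_irrefl mult_eq_0_iff of_real_eq_0_iff)
  then show ?thesis by auto
qed

lemma biorthogonal_bessel_zeros:
  obtains C c0 where "biorthogonal_bessel V {w. B w = 0} C c0 (\<lambda>k. {w. cmod w \<le> real k \<and> B w = 0})"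
proof -
  obtain C where C: "C > 0" "\<And>F a. finite F \<Longrightarrow> F \<subseteq> {w. B w = 0} \<Longrightarrow>
    (\<Sum>n. (cmod (\<Sum>w\<in>F. a w * V w n))\<^sup>2) \<le> C * (\<Sum>w\<in>F. (cmod (a w))\<^sup>2)"
    using bessel by blast
  obtain c0 where c0: "c0 > 0" "\<And>w. B w = 0 \<Longrightarrow> c0 \<le> cmod (\<Sum>n. V w n * V w n)"
    using diagonal_bound by blast
  have "biorthogonal_bessel V {w. B w = 0} C c0 (\<lambda>k. {w. cmod w \<le> real k \<and> B w = 0})"
  proof
    show "(\<Sum>n. V w n * V w' n) = 0" if "w \<in> {w. B w = 0}" "w' \<in> {w. B w = 0}" "w \<noteq> w'" for w w'
      using v_orthogonal[of w w'] that by (simp add: V_pairing)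
    show "f = (\<lambda>n. 0)" if f: "summable (\<lambda>n. (cmod (f n))\<^sup>2)"
      and ann: "\<And>w. w \<in> {w. B w = 0} \<Longrightarrow> (\<Sum>n. f n * V w n) = 0" for f
    proof (rule v_total[OF f])
      fix w assume w: "B w = 0"
      have "(\<Sum>n. f n * V w n) = (\<Sum>n. f n * v w n) / complex_of_real (nrm w)"
        unfolding V_def using suminf_divide[OF summable_mult_l2[OF f summable_v]] by simp
      then show "(\<Sum>n. f n * v w n) = 0" using ann[of w] w nrm_pos[OF zero_off[OF w]] by simp
    qed
    show "{w. cmod w \<le> real k \<and> B w = 0} \<subseteq> {w. cmod w \<le> real l \<and> B w = 0}" if "k \<le> l" for k l
      using that by (auto intro: order_trans)
    show "(\<Union>k. {w. cmod w \<le> real k \<and> B w = 0}) = {w. B w = 0}"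
      using real_arch_simple by auto
  qed (use C c0 finite_zeros summable_V in auto)
  then show thesis using that by blast
qed

end

context small_cdb
begin

subsection \<open>The space in terms of coefficient sequences\<close>

text \<open>The isometry from l2 onto the space. The interpolation formula \<open>ser_at_t\<close>
  recovers \<open>s\<close>, so every statement about the space becomes one about sequences.\<close>

definition elt :: "(nat \<Rightarrow> complex) \<Rightarrow> complex \<Rightarrow> complex" where
  "elt s = ser (\<lambda>n. s n * complex_of_real (b n))"

abbreviation l2 :: "(nat \<Rightarrow> complex) \<Rightarrow> bool" where
  "l2 s \<equiv> summable (\<lambda>n. (cmod (s n))\<^sup>2)"

lemma cdb_space_eq: "cdb_space t A \<mu> = {elt s | s. l2 s}"
  by (auto simp: cdb_space_def elt_def ser_def b_def fun_eq_iff)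

lemma summable_elt: "l2 s \<Longrightarrow> summable (\<lambda>n. s n * complex_of_real (b n) * quot n z)"
  by (rule summable_norm_cancel[OF summable_quot[OF summable_norm_mult_l2[OF _ summable_b]]])

lemma cdb_coeff_elt: "cdb_coeff t A \<mu> (elt s) = s"
proof
  fix n
  have "b n \<noteq> 0" using b_pos[of n] by simp
  then show "cdb_coeff t A \<mu> (elt s) n = s n"
    using A_simple[of n] by (simp add: cdb_coeff_def elt_def ser_at_t flip: b_def)
qed

lemma cdb_norm_elt: "cdb_norm t A \<mu> (elt s) = sqrt (\<Sum>n. (cmod (s n))\<^sup>2)"
  by (simp add: cdb_norm_def cdb_coeff_elt)

lemma cdb_norm_elt_sq: "l2 s \<Longrightarrow> (cdb_norm t A \<mu> (elt s))\<^sup>2 = (\<Sum>n. (cmod (s n))\<^sup>2)"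
  unfolding cdb_norm_elt by (intro real_sqrt_pow2 suminf_nonneg) auto

lemma elt_mult: "l2 s \<Longrightarrow> x * elt s z = elt (\<lambda>n. x * s n) z"
  using suminf_mult[OF summable_elt, of s x z] by (simp add: elt_def ser_def mult.assoc)

lemma elt_add: "l2 s \<Longrightarrow> l2 s' \<Longrightarrow> elt s z + elt s' z = elt (\<lambda>n. s n + s' n) z"
  using suminf_add[OF summable_elt summable_elt, of s s' z z] by (simp add: elt_def ser_def algebra_simps)

lemma elt_diff: "l2 s \<Longrightarrow> l2 s' \<Longrightarrow> elt s z - elt s' z = elt (\<lambda>n. s n - s' n) z"
  using suminf_diff[OF summable_elt summable_elt, of s s' z z] by (simp add: elt_def ser_def algebra_simps)

lemma elt_sum: "(\<And>i. i \<in> S \<Longrightarrow> l2 (s i)) \<Longrightarrow> (\<Sum>i\<in>S. a i * elt (s i) z) = elt (\<lambda>n. \<Sum>i\<in>S. a i * s i n) z"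
proof (induction S rule: infinite_finite_induct)
  case (insert i S)
  then have "(\<Sum>j\<in>insert i S. a j * elt (s j) z) = elt (\<lambda>n. a i * s i n) z + elt (\<lambda>n. \<Sum>j\<in>S. a j * s j n) z"
    by (simp add: elt_mult)
  also have "\<dots> = elt (\<lambda>n. a i * s i n + (\<Sum>j\<in>S. a j * s j n)) z"
    using insert by (intro elt_add summable_cmult_l2 summable_sum_l2) auto
  finally show ?case using insert by simp
qed (auto simp: elt_def ser_def)

text \<open>Evaluation at w is the pairing with the numbers b n * quot n w, whose conjugates are
  therefore the coefficients. Since the kernel is introduced by a definite description, uniqueness
  has to be checked as well; unit sequences determine each coefficient.\<close>

lemma cdb_kernel_eq:
  defines "k \<equiv> (\<lambda>w n. cnj (complex_of_real (b n) * quot n w))"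
  shows "l2 (k w)" "cdb_kernel t A \<mu> w = elt (k w)"
proof -
  obtain Q where Q: "\<And>n z. cmod z \<le> cmod w \<Longrightarrow> cmod (quot n z) \<le> Q" using quot_bounded[of "cmod w"] by blast
  show l2k: "l2 (k w)"
  proof (rule summable_comparison_test'[of _ 0])
    show "summable (\<lambda>n. \<mu> n * Q\<^sup>2)" using small by (rule summable_mult2)
    fix n
    have "(cmod (quot n w))\<^sup>2 \<le> Q\<^sup>2" using Q[of w n] by (intro power_mono) auto
    then have "\<mu> n * (cmod (quot n w))\<^sup>2 \<le> \<mu> n * Q\<^sup>2" using mu_pos[of n] by (intro mult_left_mono) auto
    then show "norm ((cmod (k w n))\<^sup>2) \<le> \<mu> n * Q\<^sup>2"
      by (simp add: k_def norm_mult power_mult_distrib power2_eq_square[of "b n"] b_sq abs_mult abs_of_pos[OF mu_pos])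
  qed
  have repr: "elt s w = cdb_inner t A \<mu> (elt s) (elt (k w))" for s
    unfolding cdb_inner_def cdb_coeff_elt by (simp add: k_def elt_def ser_def mult.assoc)
  show "cdb_kernel t A \<mu> w = elt (k w)"
    unfolding cdb_kernel_def
  proof (rule the_equality)
    show "elt (k w) \<in> cdb_space t A \<mu> \<and> (\<forall>F\<in>cdb_space t A \<mu>. F w = cdb_inner t A \<mu> F (elt (k w)))"
      using l2k repr by (auto simp: cdb_space_eq)
    fix G assume G: "G \<in> cdb_space t A \<mu> \<and> (\<forall>F\<in>cdb_space t A \<mu>. F w = cdb_inner t A \<mu> F G)"
    then obtain g where g: "G = elt g" "l2 g" by (auto simp: cdb_space_eq)
    have "g n = k w n" for n
    proof -
      define u :: "nat \<Rightarrow> complex" where "u m = (if m = n then 1 else 0)" for m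
      have u: "(\<Sum>m. u m * x m) = x n" for x
      proof -
        have "(\<Sum>m. u m * x m) = (\<Sum>m\<in>{n}. u m * x m)" by (rule suminf_finite) (auto simp: u_def)
        then show ?thesis by (simp add: u_def)
      qed
      have "l2 u" by (rule summable_finite[of "{n}"]) (auto simp: u_def)
      then have "elt u w = cdb_inner t A \<mu> (elt u) (elt g)" using G g by (auto simp: cdb_space_eq)
      with repr[of u] have "cdb_inner t A \<mu> (elt u) (elt g) = cdb_inner t A \<mu> (elt u) (elt (k w))" by simp
      then show ?thesis by (simp add: cdb_inner_def cdb_coeff_elt u)
    qed
    then show "G = elt (k w)" using g by (metis ext)
  qed
qed

text \<open>At a zero w the kernel has coefficients cnj (A w) * cnj (v w n) and norm |A w| * nrm w;
  this phase is what normalisation leaves of \<open>A w\<close>.\<close>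

definition \<theta> :: "complex \<Rightarrow> complex" where "\<theta> w = cnj (A w) / complex_of_real (cmod (A w))"

lemma cdb_nkernel_zero:
  assumes w: "B w = 0"
  shows "cdb_nkernel t A \<mu> w = elt (\<lambda>n. \<theta> w * cnj (V w n))"
proof
  fix z
  have woff: "w \<notin> range t" by (rule zero_off[OF w])
  have Aw: "cmod (A w) > 0" using A_zeros woff by simp
  have np: "nrm w > 0" by (rule nrm_pos[OF woff])
  define k where "k n = cnj (complex_of_real (b n) * quot n w)" for n
  have k: "l2 k" "cdb_kernel t A \<mu> w = elt k" unfolding k_def by (rule cdb_kernel_eq)+
  have kv: "k n = cnj (A w) * cnj (v w n)" for n by (simp add: k_def quot_off[OF woff] v_def)
  have "(\<Sum>n. (cmod (k n))\<^sup>2) = (cmod (A w))\<^sup>2 * (nrm w)\<^sup>2"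
    unfolding nrm_sq using suminf_mult[OF summable_v[of w], of "(cmod (A w))\<^sup>2"]
    by (simp add: kv norm_mult power_mult_distrib)
  then have nk: "cdb_norm t A \<mu> (elt k) = cmod (A w) * nrm w"
    using Aw np by (simp add: cdb_norm_elt real_sqrt_mult)
  have "cdb_nkernel t A \<mu> w z = (1 / complex_of_real (cmod (A w) * nrm w)) * elt k z"
    by (simp add: cdb_nkernel_def k nk)
  also have "\<dots> = elt (\<lambda>n. 1 / complex_of_real (cmod (A w) * nrm w) * k n) z" by (rule elt_mult[OF k(1)])
  also have "\<dots> = elt (\<lambda>n. \<theta> w * cnj (V w n)) z" by (simp add: kv \<theta>_def V_def)
  finally show "cdb_nkernel t A \<mu> w z = elt (\<lambda>n. \<theta> w * cnj (V w n)) z" .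
qed

lemma norm_theta: "B w = 0 \<Longrightarrow> cmod (\<theta> w) = 1"
  using A_zeros zero_off by (auto simp: \<theta>_def norm_divide)

text \<open>Conjugation is antilinear and isometric on l2, so the combination with coefficients a w
  of normalised kernels corresponds to the one with coefficients cnj (a w * \<theta> w) of the
  \<open>V w\<close>. Moduli of coefficients and norms are preserved, and the Riesz bounds carry
  over with the same constants.\<close>

theorem riesz_basis: "cdb_riesz_basis t A \<mu> {w. B w = 0} (cdb_nkernel t A \<mu>)"
proof -
  obtain C c0 where bb: "biorthogonal_bessel V {w. B w = 0} C c0 (\<lambda>k. {w. cmod w \<le> real k \<and> B w = 0})"
    using biorthogonal_bessel_zeros by blast
  interpret bb: biorthogonal_bessel V "{w. B w = 0}" C c0 "\<lambda>k. {w. cmod w \<le> real k \<and> B w = 0}" by (rule bb)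
  define x where "x w n = \<theta> w * cnj (V w n)" for w n
  have l2x: "l2 (x w)" for w
    unfolding x_def by (rule summable_cmult_l2) (simp add: summable_V)
  have comb: "(\<lambda>z. \<Sum>w\<in>S. a w * cdb_nkernel t A \<mu> w z) = elt (\<lambda>n. cnj (\<Sum>w\<in>S. cnj (a w * \<theta> w) * V w n))"
    if "S \<subseteq> {w. B w = 0}" for S a
  proof
    fix z
    have "(\<Sum>w\<in>S. a w * cdb_nkernel t A \<mu> w z) = (\<Sum>w\<in>S. a w * elt (x w) z)"
      using that by (intro sum.cong refl) (auto simp: cdb_nkernel_zero x_def[abs_def])
    also have "\<dots> = elt (\<lambda>n. \<Sum>w\<in>S. a w * x w n) z" by (rule elt_sum[OF l2x])
    also have "\<dots> = elt (\<lambda>n. cnj (\<Sum>w\<in>S. cnj (a w * \<theta> w) * V w n)) z"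
      by (simp add: x_def mult.assoc)
    finally show "(\<Sum>w\<in>S. a w * cdb_nkernel t A \<mu> w z) = elt (\<lambda>n. cnj (\<Sum>w\<in>S. cnj (a w * \<theta> w) * V w n)) z" .
  qed
  have l2comb: "l2 (\<lambda>n. cnj (\<Sum>w\<in>S. a w * V w n))" for S a
    unfolding complex_mod_cnj by (intro summable_sum_l2 summable_V)
  have norm_comb: "(cdb_norm t A \<mu> (\<lambda>z. \<Sum>w\<in>S. a w * cdb_nkernel t A \<mu> w z))\<^sup>2
      = (\<Sum>n. (cmod (\<Sum>w\<in>S. cnj (a w * \<theta> w) * V w n))\<^sup>2)"
    "(\<Sum>w\<in>S. (cmod (cnj (a w * \<theta> w)))\<^sup>2) = (\<Sum>w\<in>S. (cmod (a w))\<^sup>2)"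
    if "S \<subseteq> {w. B w = 0}" for S a
  proof -
    show "(cdb_norm t A \<mu> (\<lambda>z. \<Sum>w\<in>S. a w * cdb_nkernel t A \<mu> w z))\<^sup>2
      = (\<Sum>n. (cmod (\<Sum>w\<in>S. cnj (a w * \<theta> w) * V w n))\<^sup>2)"
      unfolding comb[OF that] by (subst cdb_norm_elt_sq[OF l2comb]) (simp only: complex_mod_cnj)
    show "(\<Sum>w\<in>S. (cmod (cnj (a w * \<theta> w)))\<^sup>2) = (\<Sum>w\<in>S. (cmod (a w))\<^sup>2)"
      using that by (intro sum.cong refl) (auto simp: norm_mult norm_theta simp del: complex_cnj_mult)
  qed
  show ?thesis
    unfolding cdb_riesz_basis_def
  proof (intro conjI ballI allI impI)
    fix w assume "w \<in> {w. B w = 0}"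
    then have "cdb_nkernel t A \<mu> w = elt (x w)" by (simp add: cdb_nkernel_zero x_def[abs_def])
    then show "cdb_nkernel t A \<mu> w \<in> cdb_space t A \<mu>" using l2x by (auto simp: cdb_space_eq)
  next
    fix F and e :: real assume F: "F \<in> cdb_space t A \<mu>" and e: "e > 0"
    then obtain f where f: "F = elt f" "l2 f" by (auto simp: cdb_space_eq)
    have l2f: "l2 (\<lambda>n. cnj (f n))" using f by simp
    \<comment> \<open>The approximation is in terms of squared norms and not strict; e / 2 leaves
      room for the strict inequality.\<close>
    obtain S a where S: "finite S" "S \<subseteq> {w. B w = 0}"
      and le: "(\<Sum>n. (cmod (cnj (f n) - (\<Sum>w\<in>S. a w * V w n)))\<^sup>2) \<le> (e / 2)\<^sup>2"
      using bb.approximation[OF l2f, of "(e / 2)\<^sup>2"] e by auto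
    define a' where "a' w = cnj (a w) / \<theta> w" for w
    have a': "cnj (a' w * \<theta> w) = a w" if "w \<in> S" for w
      using norm_theta[of w] S that by (auto simp: a'_def)
    define g where "g n = cnj (\<Sum>w\<in>S. a w * V w n)" for n
    have l2g: "l2 g" unfolding g_def by (rule l2comb)
    have "(\<lambda>z. \<Sum>w\<in>S. a' w * cdb_nkernel t A \<mu> w z) = elt g"
      unfolding comb[OF S(2)] g_def using a' by (simp cong: sum.cong del: complex_cnj_mult)
    then have "(\<Sum>w\<in>S. a' w * cdb_nkernel t A \<mu> w z) = elt g z" for z by (rule fun_cong)
    then have "(\<lambda>z. F z - (\<Sum>w\<in>S. a' w * cdb_nkernel t A \<mu> w z)) = elt (\<lambda>n. f n - g n)"
      using elt_diff[OF f(2) l2g] f(1) by auto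
    then have "cdb_norm t A \<mu> (\<lambda>z. F z - (\<Sum>w\<in>S. a' w * cdb_nkernel t A \<mu> w z)) = sqrt (\<Sum>n. (cmod (f n - g n))\<^sup>2)"
      by (simp add: cdb_norm_elt)
    also have "\<dots> = sqrt (\<Sum>n. (cmod (cnj (f n) - (\<Sum>w\<in>S. a w * V w n)))\<^sup>2)"
    proof -
      have "cmod (f n - g n) = cmod (cnj (f n) - (\<Sum>w\<in>S. a w * V w n))" for n
        unfolding g_def by (metis complex_cnj_cnj complex_cnj_diff complex_mod_cnj)
      then show ?thesis by simp
    qed
    also have "\<dots> \<le> e / 2"
      using le e by (intro real_le_lsqrt) auto
    also have "\<dots> < e" using e by simp
    finally show "\<exists>S a. finite S \<and> S \<subseteq> {w. B w = 0} \<and>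
        cdb_norm t A \<mu> (\<lambda>z. F z - (\<Sum>i\<in>S. a i * cdb_nkernel t A \<mu> i z)) < e"
      using S by blast
  next
    define c1 where "c1 = c0\<^sup>2 / C"
    have c1: "c1 > 0" using bb.c_pos bb.C_pos by (simp add: c1_def)
    show "\<exists>c C. 0 < c \<and> c \<le> C \<and> (\<forall>S a. finite S \<longrightarrow> S \<subseteq> {w. B w = 0} \<longrightarrow>
         c * (\<Sum>i\<in>S. (cmod (a i))\<^sup>2) \<le> (cdb_norm t A \<mu> (\<lambda>z. \<Sum>i\<in>S. a i * cdb_nkernel t A \<mu> i z))\<^sup>2 \<and>
         (cdb_norm t A \<mu> (\<lambda>z. \<Sum>i\<in>S. a i * cdb_nkernel t A \<mu> i z))\<^sup>2 \<le> C * (\<Sum>i\<in>S. (cmod (a i))\<^sup>2))"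
    \<comment> \<open>The maximum provides the order of the two constants that the definition of a
      Riesz basis demands.\<close>
    proof (rule exI[of _ c1], rule exI[of _ "max C c1"], intro conjI allI impI)
      fix S and a :: "complex \<Rightarrow> complex" assume S: "finite S" "S \<subseteq> {w. B w = 0}"
      note nc = norm_comb[OF S(2), of a]
      show "c1 * (\<Sum>i\<in>S. (cmod (a i))\<^sup>2) \<le> (cdb_norm t A \<mu> (\<lambda>z. \<Sum>i\<in>S. a i * cdb_nkernel t A \<mu> i z))\<^sup>2"
        using bb.lower_bound[OF S, of "\<lambda>w. cnj (a w * \<theta> w)"] unfolding nc c1_def .
      have "C * (\<Sum>i\<in>S. (cmod (a i))\<^sup>2) \<le> max C c1 * (\<Sum>i\<in>S. (cmod (a i))\<^sup>2)"
        by (intro mult_right_mono sum_nonneg) auto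
      then show "(cdb_norm t A \<mu> (\<lambda>z. \<Sum>i\<in>S. a i * cdb_nkernel t A \<mu> i z))\<^sup>2 \<le> max C c1 * (\<Sum>i\<in>S. (cmod (a i))\<^sup>2)"
        using bb.bessel[OF S, of "\<lambda>w. cnj (a w * \<theta> w)"] unfolding nc by linarith
    qed (use c1 in auto)
  qed
qed

end

section \<open>From power separation to the standing assumptions\<close>

lemma riesz_basis_of_power_separated:
  fixes t :: "nat \<Rightarrow> complex" and \<mu> :: "nat \<Rightarrow> real"
    and A :: "complex \<Rightarrow> complex" and \<gamma> :: complex
  assumes t_inf: "filterlim (\<lambda>n. cmod (t n)) at_top sequentially"
    and mu_pos: "\<And>n. \<mu> n > 0"
    and A_entire: "A holomorphic_on UNIV"
    and A_zeros: "\<And>z. A z = 0 \<longleftrightarrow> z \<in> range t"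
    and A_simple: "\<And>n. deriv A (t n) \<noteq> 0"
    and small: "summable \<mu>"
    and gamma: "\<gamma> \<noteq> 0"
    and B_simple: "\<And>w. cdb_B t A \<mu> \<gamma> w = 0 \<Longrightarrow> deriv (cdb_B t A \<mu> \<gamma>) w \<noteq> 0"
    and N: "N \<ge> 0" and C: "C > 0"
    and sep: "\<And>m n. m \<noteq> n \<Longrightarrow> C * (cmod (t n) + 1) powr (- N) \<le> cmod (t n - t m)"
    and lim: "(\<lambda>n. cmod (t n) powr (2 * N) * \<mu> n) \<longlonglongrightarrow> 0"
  shows "cdb_riesz_basis t A \<mu> {w. cdb_B t A \<mu> \<gamma> w = 0} (cdb_nkernel t A \<mu>)"
proof -
  \<comment> \<open>Lowering the constant to at most 1 ensures d n \<le> 1; rounding N up to the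
    integer \<open>K\<close> allows ordinary powers in the growth bounds.\<close>
  define c where "c = min C 1"
  define d where "d n = c * (cmod (t n) + 1) powr (- N)" for n
  define K where "K = nat \<lceil>N\<rceil>"
  have c: "c > 0" "c \<le> 1" "c \<le> C" using C by (auto simp: c_def)
  have tp: "cmod (t n) + 1 \<ge> 1" "cmod (t n) + 1 > 0" for n using norm_ge_zero[of "t n"] by linarith+
  have K: "N \<le> real K" unfolding K_def by linarith
  have "small_cdb t \<mu> A \<gamma> d c K"
  proof (unfold_locales)
    show "d n > 0" for n unfolding d_def using c(1) tp(2)[of n] by (simp add: less_imp_neq[symmetric])
    show "d n \<le> 1" for n
    proof -
      have "(cmod (t n) + 1) powr (- N) \<le> 1"
        using powr_mono[of "- N" 0 "cmod (t n) + 1"] tp(1)[of n] N by simp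
      then have "c * (cmod (t n) + 1) powr (- N) \<le> 1 * 1" using c by (intro mult_mono) auto
      then show ?thesis by (simp add: d_def)
    qed
    show "d n \<le> dist (t n) (t m)" if "m \<noteq> n" for m n
    proof -
      have "d n \<le> C * (cmod (t n) + 1) powr (- N)" unfolding d_def using c by (intro mult_right_mono) auto
      also have "\<dots> \<le> dist (t n) (t m)" using sep[OF that] by (simp add: dist_norm)
      finally show ?thesis .
    qed
    show "c \<le> d n * (cmod (t n) + 1) ^ K" for n
    proof -
      have "d n * (cmod (t n) + 1) ^ K = c * (cmod (t n) + 1) powr (real K - N)"
        using tp(2)[of n] by (simp add: d_def powr_realpow[symmetric] powr_add[symmetric])
      also have "\<dots> \<ge> c * 1" using tp(1)[of n] K c by (intro mult_left_mono ge_one_powr_ge_zero) auto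
      finally show ?thesis by simp
    qed
    show "(\<lambda>n. \<mu> n / (d n)\<^sup>2) \<longlonglongrightarrow> 0"
    proof (rule Lim_null_comparison)
      \<comment> \<open>The factor 2 powr (2 * N) comes from |t n| + 1 \<le> 2 |t n|, valid for all
        large n.\<close>
      show "(\<lambda>n. 2 powr (2 * N) / c\<^sup>2 * (cmod (t n) powr (2 * N) * \<mu> n)) \<longlonglongrightarrow> 0"
        using tendsto_mult_left[OF lim, of "2 powr (2 * N) / c\<^sup>2"] by simp
      have "\<forall>\<^sub>F n in sequentially. 1 \<le> cmod (t n)" using t_inf unfolding filterlim_at_top by blast
      then show "\<forall>\<^sub>F n in sequentially. norm (\<mu> n / (d n)\<^sup>2) \<le> 2 powr (2 * N) / c\<^sup>2 * (cmod (t n) powr (2 * N) * \<mu> n)"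
      proof eventually_elim
        case (elim n)
        have "\<mu> n / (d n)\<^sup>2 = (cmod (t n) + 1) powr (2 * N) * \<mu> n / c\<^sup>2"
        proof -
          have "(d n)\<^sup>2 = c\<^sup>2 * (cmod (t n) + 1) powr (- (2 * N))"
            using tp(2)[of n] by (simp add: d_def power_mult_distrib power2_eq_square powr_add[symmetric])
          then show ?thesis by (simp add: powr_minus divide_inverse)
        qed
        also have "\<dots> \<le> (2 * cmod (t n)) powr (2 * N) * \<mu> n / c\<^sup>2"
          using elim N mu_pos[of n] by (intro divide_right_mono mult_right_mono powr_mono2) auto
        also have "\<dots> = 2 powr (2 * N) / c\<^sup>2 * (cmod (t n) powr (2 * N) * \<mu> n)" by (simp add: powr_mult)
        finally show ?case using mu_pos[of n] by (simp add: abs_of_pos)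
      qed
    qed
  qed (use assms c in auto)
  then show ?thesis by (rule small_cdb.riesz_basis)
qed

theorem theorem1p7:
  fixes t :: "nat \<Rightarrow> complex" and \<mu> :: "nat \<Rightarrow> real"
    and A :: "complex \<Rightarrow> complex" and \<gamma> :: complex
  assumes t_inj: "inj t"
    and t_inf: "filterlim (\<lambda>n. cmod (t n)) at_top sequentially"
    and mu_pos: "\<And>n. \<mu> n > 0"
    and mu_sum: "summable (\<lambda>n. \<mu> n / ((cmod (t n))\<^sup>2 + 1))"
    and A_entire: "A holomorphic_on UNIV"
    and A_zeros: "\<And>z. A z = 0 \<longleftrightarrow> z \<in> range t"
    and A_simple: "\<And>n. deriv A (t n) \<noteq> 0"
    and small: "summable \<mu>"
    and gamma: "\<gamma> \<noteq> 0"
    and B_simple: "\<And>w. cdb_B t A \<mu> \<gamma> w = 0 \<Longrightarrow> deriv (cdb_B t A \<mu> \<gamma>) w \<noteq> 0"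
  shows "((\<exists>N p. power_separated t N \<and> p > 0 \<and>
              summable (\<lambda>n. (cmod (t n) powr (2 * N) * \<mu> n) powr p))
            \<longrightarrow> cdb_riesz_basis t A \<mu> {w. cdb_B t A \<mu> \<gamma> w = 0} (cdb_nkernel t A \<mu>))
       \<and> (separated t
            \<longrightarrow> cdb_riesz_basis t A \<mu> {w. cdb_B t A \<mu> \<gamma> w = 0} (cdb_nkernel t A \<mu>))"
proof -
  note basis = riesz_basis_of_power_separated[OF t_inf mu_pos A_entire A_zeros A_simple small gamma B_simple]
  have sep: "cdb_riesz_basis t A \<mu> {w. cdb_B t A \<mu> \<gamma> w = 0} (cdb_nkernel t A \<mu>)" if "separated t"
  proof -
    obtain \<delta> where \<delta>: "\<delta> > 0" "\<And>n m. n \<noteq> m \<Longrightarrow> cmod (t n - t m) \<ge> \<delta>"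
      using \<open>separated t\<close> unfolding separated_def by blast
    show ?thesis
    \<comment> \<open>Separation is power separation with exponent 0, where the decay condition
      reduces to mu n -> 0.\<close>
    proof (rule basis[of 0 \<delta>])
      show "\<delta> * (cmod (t n) + 1) powr - 0 \<le> cmod (t n - t m)" if "m \<noteq> n" for m n
        using \<delta>(2)[of n m] that \<delta>(1) by (simp add: mult_le_cancel_left1)
      show "(\<lambda>n. cmod (t n) powr (2 * 0) * \<mu> n) \<longlonglongrightarrow> 0"
      proof (rule Lim_null_comparison)
        show "\<mu> \<longlonglongrightarrow> 0" using small by (rule summable_LIMSEQ_zero)
        show "\<forall>\<^sub>F n in sequentially. norm (cmod (t n) powr (2 * 0) * \<mu> n) \<le> \<mu> n"
          using mu_pos by (intro always_eventually allI) (simp add: abs_of_pos less_imp_le)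
      qed
    qed (use \<delta> in auto)
  qed
  have "cdb_riesz_basis t A \<mu> {w. cdb_B t A \<mu> \<gamma> w = 0} (cdb_nkernel t A \<mu>)"
    if ps: "power_separated t N" and p: "p > 0"
      and sm: "summable (\<lambda>n. (cmod (t n) powr (2 * N) * \<mu> n) powr p)" for N p
  proof -
    obtain C where C: "C > 0" "\<And>n m. m \<noteq> n \<Longrightarrow> cmod (t n - t m) \<ge> C * (cmod (t n) + 1) powr (- N)"
      using ps unfolding power_separated_def by blast
    show ?thesis
    proof (cases "N \<ge> 0")
      case True
      \<comment> \<open>Terms of a convergent series tend to 0, and so do their powers of exponent 1
        / p, whatever the size of p.\<close>
      have "(\<lambda>n. ((cmod (t n) powr (2 * N) * \<mu> n) powr p) powr (1 / p)) \<longlonglongrightarrow> 0 powr (1 / p)"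
        using p by (intro tendsto_powr' summable_LIMSEQ_zero[OF sm] tendsto_const) auto
      then have "(\<lambda>n. cmod (t n) powr (2 * N) * \<mu> n) \<longlonglongrightarrow> 0"
        using p mu_pos by (simp add: powr_powr less_imp_le)
      with True C show ?thesis by (intro basis[of N C]) auto
    next
      case False
      \<comment> \<open>For negative N the lower bound on distances is at least C, so this case
        falls under the separated one.\<close>
      have "separated t"
        unfolding separated_def
      proof (intro exI[of _ C] conjI allI impI)
        fix n m :: nat assume "n \<noteq> m"
        have "C * 1 \<le> C * (cmod (t n) + 1) powr (- N)"
          using C(1) False by (intro mult_left_mono ge_one_powr_ge_zero) auto
        also have "\<dots> \<le> cmod (t n - t m)" using C(2)[of m n] \<open>n \<noteq> m\<close> by simp
        finally show "C \<le> cmod (t n - t m)" by simp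
      qed (rule C(1))
      then show ?thesis by (rule sep)
    qed
  qed
  with sep show ?thesis by blast
qed

end
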